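(* Let $\{X_t\}_{t\in\mathbb{Z}}$ be a FIEGARCH$(p,d,q)$ process. If $\mathbb{E}([\ln(Z_0^2)]^2)<\infty$ and $d<0.5$, then the process $\{\ln(X_t^2)\}_{t\in\mathbb{Z}}$ is well defined (each $\ln(X_t^2)$ is almost surely finite) and it is weakly and strictly stationary and ergodic. Moreover, its autocovariance function is given, for all $h\in\mathbb{Z}$, by $$\gamma_{\ln(X^2)}(h)=\sigma_g^2\sum_{k=0}^\infty\lambda_{d,k}\lambda_{d,k+|h|}+\mathrm{Var}\big(\ln(Z_0^2)\big)\,\mathbb{I}_{\{0\}}(h)+\lambda_{d,|h|-1}\,\mathcal{K}\,\mathbb{I}_{\mathbb{Z}\setminus\{0\}}(h),$$ where $\sigma_g^2=\theta^2+\gamma^2-[\gamma\,\mathbb{E}(|Z_0|)]^2+2\theta\gamma\,\mathbb{E}(Z_0|Z_0|)$ and $\mathcal{K}=\mathrm{Cov}\big(g(Z_0),\ln(Z_0^2)\big)$.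
   Context: FIEGARCH$(p,d,q)$: let $\{Z_t\}_{t\in\mathbb{Z}}$ be i.i.d. real random variables with mean $0$ and variance $1$; let $d,\omega,\theta,\gamma\in\mathbb{R}$; let $\alpha(z)=1-\sum_{i=1}^p\alpha_iz^i$, $\beta(z)=1-\sum_{j=1}^q\beta_jz^j$ be real polynomials with no common roots and $\beta(z)\neq0$ for $|z|\le1$. Let $\lambda_{d,k}$ be defined by $\frac{\alpha(z)}{\beta(z)}(1-z)^{-d}=\sum_{k=0}^\infty\lambda_{d,k}z^k$ for $|z|<1$, and put $g(Z_t)=\theta Z_t+\gamma\,[\,|Z_t|-\mathbb{E}(|Z_t|)\,]$. Then $X_t=\sigma_tZ_t$ with $\sigma_t>0$ given by $$\ln(\sigma_t^2)=\omega+\sum_{k=0}^\infty\lambda_{d,k}\,g(Z_{t-1-k}),\qquad t\in\mathbb{Z},$$ the series being the almost sure limit of its partial sums. $\mathbb{I}_A$ is the indicator function of $A$; the last term of the autocovariance formula is $0$ when $h=0$. The autocovariance function is $\gamma_{\ln(X^2)}(h)=\mathrm{Cov}(\ln(X_{t+h}^2),\ln(X_t^2))$. *)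

theory Defs
  imports "HOL-Probability.Probability" "HOL-Computational_Algebra.Polynomial"
begin

definition lag_poly :: "nat \<Rightarrow> (nat \<Rightarrow> real) \<Rightarrow> complex poly" where
  "lag_poly n c = 1 - (\<Sum>i=1..n. monom (complex_of_real (c i)) i)"

text \<open>The paper's function $g$, applied to a random variable: the centring constant depends on the
  distribution of the argument.\<close>

definition news :: "'a measure \<Rightarrow> real \<Rightarrow> real \<Rightarrow> ('a \<Rightarrow> real) \<Rightarrow> 'a \<Rightarrow> real" where
  "news M \<theta> \<gamma> U = (\<lambda>x. \<theta> * U x + \<gamma> * (\<bar>U x\<bar> - (\<integral>y. \<bar>U y\<bar> \<partial>M)))"

definition log_sq :: "('a \<Rightarrow> real) \<Rightarrow> 'a \<Rightarrow> real" where
  "log_sq U = (\<lambda>x. ln ((U x)\<^sup>2))"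

text \<open>Since \<open>ln 0 = 0\<close> holds for the real logarithm, finiteness of $\ln(X_t^2)$ and of
  $E([\ln(Z_0^2)]^2)$ has to be stated with the extended logarithm, for which $\ln 0 = -\infty$.\<close>

definition ext_ln :: "real \<Rightarrow> ereal" where
  "ext_ln r = (if r \<le> 0 then - \<infinity> else ereal (ln r))"

definition ext_log_sq :: "('a \<Rightarrow> real) \<Rightarrow> 'a \<Rightarrow> ereal" where
  "ext_log_sq U = (\<lambda>x. ext_ln ((U x)\<^sup>2))"

definition covar :: "'a measure \<Rightarrow> ('a \<Rightarrow> real) \<Rightarrow> ('a \<Rightarrow> real) \<Rightarrow> real" where
  "covar M U V = (\<integral>x. (U x - (\<integral>y. U y \<partial>M)) * (V x - (\<integral>y. V y \<partial>M)) \<partial>M)"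

definition weakly_stationary :: "'a measure \<Rightarrow> (int \<Rightarrow> 'a \<Rightarrow> real) \<Rightarrow> bool" where
  "weakly_stationary M Y \<longleftrightarrow>
     (\<forall>t. Y t \<in> borel_measurable M \<and> integrable M (\<lambda>x. (Y t x)\<^sup>2)) \<and>
     (\<forall>t. (\<integral>x. Y t x \<partial>M) = (\<integral>x. Y 0 x \<partial>M)) \<and>
     (\<forall>t h. covar M (Y (t + h)) (Y t) = covar M (Y h) (Y 0))"

definition strictly_stationary :: "'a measure \<Rightarrow> (int \<Rightarrow> 'a \<Rightarrow> real) \<Rightarrow> bool" where
  "strictly_stationary M Y \<longleftrightarrow>
     (\<forall>t. Y t \<in> borel_measurable M) \<and>
     (\<forall>J h. finite J \<longrightarrow>
        distr M (\<Pi>\<^sub>M j\<in>J. borel) (\<lambda>x. \<lambda>j\<in>J. Y (j + h) x) =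
        distr M (\<Pi>\<^sub>M j\<in>J. borel) (\<lambda>x. \<lambda>j\<in>J. Y j x))"

text \<open>Every shift-invariant event of the path space $\mathbb{R}^{\mathbb{Z}}$ has probability $0$ or
  $1$ under the law of the process.\<close>

definition ergodic :: "'a measure \<Rightarrow> (int \<Rightarrow> 'a \<Rightarrow> real) \<Rightarrow> bool" where
  "ergodic M Y \<longleftrightarrow>
     (\<forall>A \<in> sets (\<Pi>\<^sub>M t\<in>(UNIV :: int set). (borel :: real measure)).
        {f. (\<lambda>t. f (t + 1)) \<in> A} = A \<longrightarrow>
        measure M {x \<in> space M. (\<lambda>t. Y t x) \<in> A} \<in> {0, 1})"

text \<open>Convergence of the series for $\ln(\sigma_t^2)$ is not assumed. Where the series converges,
  \<open>suminf\<close> is the limit of its partial sums; elsewhere its value is unspecified.\<close>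

locale fiegarch = prob_space M for M :: "'a measure" +
  fixes Z :: "int \<Rightarrow> 'a \<Rightarrow> real"
    and p :: nat and d :: real and q :: nat
    and \<omega> \<theta> \<gamma> :: real
    and \<alpha> \<beta> :: "nat \<Rightarrow> real"
    and lam :: "nat \<Rightarrow> real"
    and \<sigma> X :: "int \<Rightarrow> 'a \<Rightarrow> real"
  assumes Z_indep: "indep_vars (\<lambda>_. borel) Z UNIV"
    and Z_ident: "\<And>t. distr M borel (Z t) = distr M borel (Z 0)"
    and Z_integrable: "integrable M (Z 0)" "integrable M (\<lambda>x. (Z 0 x)\<^sup>2)"
    and Z_mean: "expectation (Z 0) = 0"
    and Z_variance: "variance (Z 0) = 1"
    and no_common_roots:
      "\<not> (\<exists>z. poly (lag_poly p \<alpha>) z = 0 \<and> poly (lag_poly q \<beta>) z = 0)"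
    and beta_nonzero: "\<And>z. norm z \<le> 1 \<Longrightarrow> poly (lag_poly q \<beta>) z \<noteq> 0"
    and lam_expansion: "\<And>z. norm z < 1 \<Longrightarrow>
      (\<lambda>k. complex_of_real (lam k) * z ^ k) sums
        (poly (lag_poly p \<alpha>) z / poly (lag_poly q \<beta>) z * (1 - z) powr (- complex_of_real d))"
    and sigma_measurable: "\<And>t. \<sigma> t \<in> borel_measurable M"
    and sigma_pos: "\<And>t. AE x in M. \<sigma> t x > 0"
    and sigma_eq: "\<And>t. AE x in M.
      ln ((\<sigma> t x)\<^sup>2) = \<omega> + (\<Sum>k. lam k * news M \<theta> \<gamma> (Z (t - 1 - int k)) x)"
    and X_measurable: "\<And>t. X t \<in> borel_measurable M"
    and X_eq: "\<And>t. AE x in M. X t x = \<sigma> t x * Z t x"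

end

theory Submission
  imports Defs "HOL-Complex_Analysis.Complex_Analysis"
begin

text \<open>Since $\beta$ has no zeros in the closed unit disc, $\alpha/\beta$ is holomorphic on a larger disc and
  its Taylor coefficients are absolutely summable; those of $(1-z)^{-d}$ are of order $k^{d-1}$, hence
  square summable for $d < 1/2$. The $\lambda_{d,k}$ are the convolution of the two sequences, so they are
  square summable by Young's inequality. Kolmogorov's maximal inequality then gives almost sure
  convergence of $\sum_k \lambda_{d,k}\, g(Z_{t-1-k})$; by Fatou's lemma the limit is also the limit in
  $L^2$, so that covariances may be computed termwise.
  Almost surely $\ln(X_t^2) = F((Z_{s+t})_s)$ for one measurable $F$ on the path space, so
  stationarity and ergodicity are inherited from the Bernoulli shift. The latter is ergodic because an
  invariant event $A$ is approximated by a cylinder event $C$, and a translate $C'$ of $C$ that depends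
  on disjoint coordinates is independent of $C$ and still close to $A$, whence $P(A) = P(A)^2$.\<close>

subsection \<open>Square summability of the coefficients\<close>

text \<open>For 0 < d < 1/2 the coefficients \<open>lam k\<close> are in general not absolutely
  summable, so the series for the log-volatility cannot be controlled pathwise by absolute
  convergence. Its convergence rests on cancellation between independent centred terms, and
  expectations are moved inside it through L^2 bounds. The autocovariance has its shape because the
  logarithm of the squared process splits into a constant, a part built from the noise strictly
  before t, and a part depending on \<open>Z t\<close> alone. For h > 0 the past part at time t + h
  contains g of \<open>Z t\<close> with weight \<open>lam (h - 1)\<close>; its correlation with the
  log-noise at time t produces the term with K, while the opposite mixed product has mean zero. The
  real logarithm satisfies ln 0 = 0, so an atom of the noise at 0 would be invisible to real-valued
  moments. The extended moment hypothesis excludes it, and this is what allows the logarithm of the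
  product of volatility and noise to be split into a sum.\<close>

lemma summable_convolution_square:
  fixes a b :: "nat \<Rightarrow> real"
  assumes b: "summable b" "\<And>n. 0 \<le> b n" and a: "summable (\<lambda>n. (a n)\<^sup>2)"
  shows "summable (\<lambda>n. (\<Sum>i\<le>n. b i * a (n - i))\<^sup>2)"
proof (rule summable_comparison_test')
  have "summable (\<lambda>n. \<Sum>i\<le>n. b i * (a (n - i))\<^sup>2)"
    by (rule summable_Cauchy_product) (use a b in auto)
  then show "summable (\<lambda>n. suminf b * (\<Sum>i\<le>n. b i * (a (n - i))\<^sup>2))"
    by (rule summable_mult)
  fix n :: nat
  \<comment> \<open>Half of the weight \<open>b i\<close> goes to each factor of Cauchy-Schwarz: one
    factor is then bounded by \<open>suminf b\<close>, the other is a Cauchy product of two summable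
    sequences.\<close>
  have "(\<Sum>i\<le>n. b i * a (n - i))\<^sup>2 = (\<Sum>i\<le>n. sqrt (b i) * (sqrt (b i) * a (n - i)))\<^sup>2"
    using b(2) by (simp flip: mult.assoc)
  also have "\<dots> \<le> (\<Sum>i\<le>n. (sqrt (b i))\<^sup>2) * (\<Sum>i\<le>n. (sqrt (b i) * a (n - i))\<^sup>2)"
    by (rule Cauchy_Schwarz_ineq_sum)
  also have "\<dots> = (\<Sum>i\<le>n. b i) * (\<Sum>i\<le>n. b i * (a (n - i))\<^sup>2)"
    using b(2) by (simp add: power_mult_distrib)
  also have "\<dots> \<le> suminf b * (\<Sum>i\<le>n. b i * (a (n - i))\<^sup>2)"
    by (intro mult_right_mono sum_le_suminf b(1) sum_nonneg mult_nonneg_nonneg) (auto simp: b(2))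
  finally show "norm ((\<Sum>i\<le>n. b i * a (n - i))\<^sup>2) \<le> suminf b * (\<Sum>i\<le>n. b i * (a (n - i))\<^sup>2)"
    by simp
qed

text \<open>The generalized binomial coefficient times \<open>(-1) ^ n\<close> and n^(1-d)
  converges, and only the resulting boundedness is kept; this covers the nonpositive integers d,
  where the limit is 0. Squaring leaves the exponent 2d - 2, which is below -1 exactly when d <
  1/2.\<close>

lemma summable_square_gchoose:
  fixes d :: real
  assumes "d < 1 / 2"
  shows "summable (\<lambda>n. ((- d) gchoose n)\<^sup>2)"
proof -
  have "convergent (\<lambda>n. ((- d) gchoose n) / ((-1)^n / exp ((- d + 1) * ln (real n))))"
    using gbinomial_asymptotic[of "- d"] by (auto intro: convergentI)
  from convergent_imp_Bseq[OF this] obtain K where K: "\<And>n. norm (((- d) gchoose n) / ((-1)^n / exp ((- d + 1) * ln (real n)))) \<le> K"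
    unfolding Bseq_def by blast
  show ?thesis
  proof (rule summable_comparison_test')
    show "summable (\<lambda>n. K\<^sup>2 * real n powr (2 * d - 2))"
      using assms by (intro summable_mult) (simp add: summable_real_powr_iff)
    fix n :: nat assume n: "n \<ge> 1"
    have "\<bar>(- d) gchoose n\<bar> * exp ((1 - d) * ln (real n)) \<le> K"
      using K[of n] by (simp add: abs_mult power_abs)
    then have "(\<bar>(- d) gchoose n\<bar> * exp ((1 - d) * ln (real n))) * exp ((d - 1) * ln (real n)) \<le> K * exp ((d - 1) * ln (real n))"
      by (intro mult_right_mono) auto
    then have "\<bar>(- d) gchoose n\<bar> \<le> K * exp ((d - 1) * ln (real n))"
      by (simp add: mult.assoc algebra_simps flip: exp_add)
    then have "\<bar>(- d) gchoose n\<bar>\<^sup>2 \<le> (K * exp ((d - 1) * ln (real n)))\<^sup>2"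
      by (intro power_mono) auto
    also have "\<dots> = K\<^sup>2 * exp (2 * ((d - 1) * ln (real n)))"
      by (simp add: power_mult_distrib exp_double)
    also have "\<dots> = K\<^sup>2 * real n powr (2 * d - 2)"
      using n by (simp add: powr_def algebra_simps)
    finally show "norm (((- d) gchoose n)\<^sup>2) \<le> K\<^sup>2 * real n powr (2 * d - 2)" by simp
  qed
qed

lemma rational_coeffs_abs_summable:
  fixes A B :: "complex poly"
  assumes "\<And>z. norm z \<le> 1 \<Longrightarrow> poly B z \<noteq> 0"
  obtains c where "summable (\<lambda>n. norm (c n))"
    "\<And>z. norm z < 1 \<Longrightarrow> (\<lambda>n. c n * z ^ n) sums (poly A z / poly B z)"
proof -
  have "B \<noteq> 0" using assms[of 0] by auto
  then have fin: "finite {z. poly B z = 0}" by (rule poly_roots_finite)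
  obtain R where R: "R > 1" "\<And>z. norm z < R \<Longrightarrow> poly B z \<noteq> 0"
  proof
    \<comment> \<open>The element 2 keeps the minimum meaningful when \<open>B\<close> has no roots.
      All roots lie strictly outside the closed disc and are finitely many, so the minimum exceeds
      1.\<close>
    let ?R = "Min (insert 2 (norm ` {z. poly B z = 0}))"
    have "norm z > 1" if "poly B z = 0" for z
      using assms that not_le by blast
    then show "?R > 1" using fin by simp
    show "poly B z \<noteq> 0" if "norm z < ?R" for z
      using that fin by auto
  qed
  define c where "c n = (deriv ^^ n) (\<lambda>z. poly A z / poly B z) 0 / fact n" for n
  have "(\<lambda>z. poly A z / poly B z) holomorphic_on ball 0 R"
    using R by (intro holomorphic_intros) auto
  from holomorphic_power_series[OF this]
  have c: "(\<lambda>n. c n * z ^ n) sums (poly A z / poly B z)" if "norm z < R" for z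
    using that by (simp add: c_def)
  \<comment> \<open>Convergence at a point of modulus strictly between 1 and \<open>R\<close> forces
    absolute convergence at 1.\<close>
  define r where "r = (1 + R) / 2"
  have r: "1 < r" "r < R" using R by (auto simp: r_def)
  have "summable (\<lambda>n. norm (c n * 1 ^ n))"
    by (rule powser_insidea[OF sums_summable[OF c[of "of_real r"]]]) (use r in auto)
  then show thesis
    using that c R by force
qed

text \<open>The \<open>lam k\<close> are known only through the function that they expand;
  identifying them with a convolution of explicit coefficients needs this uniqueness, obtained from
  formal power series that agree near 0.\<close>

lemma powser_unique:
  fixes a b :: "nat \<Rightarrow> complex"
  assumes a: "\<And>z. norm z < 1 \<Longrightarrow> (\<lambda>n. a n * z ^ n) sums f z"
    and b: "\<And>z. norm z < 1 \<Longrightarrow> (\<lambda>n. b n * z ^ n) sums f z"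
  shows "a = b"
proof -
  have pos: "fps_conv_radius (Abs_fps u) > 0"
    if "\<And>z. norm z < 1 \<Longrightarrow> (\<lambda>n. u n * z ^ n) sums f z" for u
  proof -
    have "conv_radius u \<ge> norm (1/2 :: complex)"
      by (rule conv_radius_geI, rule sums_summable, rule that) simp
    then show ?thesis
      by (auto simp: fps_conv_radius_def intro: less_le_trans[rotated])
  qed
  have "eventually (\<lambda>z. z \<in> ball (0::complex) 1) (nhds 0)"
    by (intro eventually_nhds_in_open) auto
  then have "eventually (\<lambda>z. eval_fps (Abs_fps a) z = eval_fps (Abs_fps b) z) (nhds 0)"
    by eventually_elim (use sums_unique[OF a] sums_unique[OF b] in \<open>auto simp: eval_fps_def\<close>)
  from eval_fps_eqD[OF pos[OF a] pos[OF b] this] show ?thesis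
    by (simp add: fps_eq_iff fun_eq_iff)
qed

lemma fractional_coeffs_square_summable:
  fixes A B :: "complex poly" and d :: real and l :: "nat \<Rightarrow> real"
  assumes B: "\<And>z. norm z \<le> 1 \<Longrightarrow> poly B z \<noteq> 0" and d: "d < 1 / 2"
    and l: "\<And>z. norm z < 1 \<Longrightarrow> (\<lambda>k. complex_of_real (l k) * z ^ k) sums
        (poly A z / poly B z * (1 - z) powr (- complex_of_real d))"
  shows "summable (\<lambda>k. (l k)\<^sup>2)"
proof -
  obtain c where c: "summable (\<lambda>n. norm (c n))"
    "\<And>z. norm z < 1 \<Longrightarrow> (\<lambda>n. c n * z ^ n) sums (poly A z / poly B z)"
    using rational_coeffs_abs_summable[OF B] by blast
  \<comment> \<open>The binomial series is applied at \<open>- z\<close>; the sign is absorbed into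
    the coefficient of \<open>z ^ n\<close>.\<close>
  define a where "a n = (-1) ^ n * ((- d) gchoose n)" for n
  have a: "(\<lambda>n. complex_of_real (a n) * z ^ n) sums ((1 - z) powr (- complex_of_real d))"
    if "norm z < 1" for z
  proof -
    have "(\<lambda>n. (complex_of_real (- d) gchoose n) * (- z) ^ n) sums (1 + (- z)) powr (complex_of_real (- d))"
      by (rule gen_binomial_complex) (use that in simp)
    moreover have "(complex_of_real (- d) gchoose n) * (- z) ^ n = complex_of_real (a n) * z ^ n" for n
    proof -
      have "complex_of_real (- d) gchoose n = complex_of_real ((- d) gchoose n)"
        by (simp add: gbinomial_prod_rev)
      then show ?thesis
        by (simp add: a_def power_minus[of z])
    qed
    ultimately show ?thesis by simp
  qed
  have "(\<lambda>n. complex_of_real (l n)) = (\<lambda>n. \<Sum>i\<le>n. c i * complex_of_real (a (n - i)))"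
  proof (rule powser_unique[OF l])
    fix z :: complex assume z: "norm z < 1"
    \<comment> \<open>A point of modulus strictly between that of \<open>z\<close> and 1. Both
      series converge there, hence absolutely at \<open>z\<close>, as the Cauchy product
      requires.\<close>
    define z' where "z' = complex_of_real ((1 + norm z) / 2)"
    have "norm z < norm z'" "norm z' < 1" using z by (auto simp: z'_def simp del: of_real_divide of_real_add)
    then have s: "summable (\<lambda>n. norm (c n * z ^ n))" "summable (\<lambda>n. norm (complex_of_real (a n) * z ^ n))"
      using powser_insidea[OF sums_summable[OF c(2)[of z']]] powser_insidea[OF sums_summable[OF a[of z']]]
      by blast+
    have "(\<lambda>n. \<Sum>i\<le>n. (c i * z ^ i) * (complex_of_real (a (n - i)) * z ^ (n - i))) sums
       ((\<Sum>n. c n * z ^ n) * (\<Sum>n. complex_of_real (a n) * z ^ n))"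
      by (rule Cauchy_product_sums[OF s])
    also have "(\<lambda>n. \<Sum>i\<le>n. (c i * z ^ i) * (complex_of_real (a (n - i)) * z ^ (n - i))) =
        (\<lambda>n. (\<Sum>i\<le>n. c i * complex_of_real (a (n - i))) * z ^ n)"
    proof (intro ext, unfold sum_distrib_right, intro sum.cong refl)
      fix n i :: nat assume "i \<in> {..n}"
      then have "z ^ n = z ^ i * z ^ (n - i)" by (simp flip: power_add)
      then show "c i * z ^ i * (complex_of_real (a (n - i)) * z ^ (n - i)) = c i * complex_of_real (a (n - i)) * z ^ n"
        by (simp only: mult_ac)
    qed
    finally show "(\<lambda>n. (\<Sum>i\<le>n. c i * complex_of_real (a (n - i))) * z ^ n) sums
        (poly A z / poly B z * (1 - z) powr (- complex_of_real d))"
      using sums_unique[OF c(2)[OF z]] sums_unique[OF a[OF z]] by simp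
  qed
  then have "complex_of_real (l n) = (\<Sum>i\<le>n. c i * complex_of_real (a (n - i)))" for n
    by meson
  then have "\<bar>l n\<bar> \<le> (\<Sum>i\<le>n. norm (c i) * \<bar>a (n - i)\<bar>)" for n
    by (metis (no_types, lifting) norm_of_real norm_mult sum_norm_le order_refl)
  then have *: "(l n)\<^sup>2 \<le> (\<Sum>i\<le>n. norm (c i) * \<bar>a (n - i)\<bar>)\<^sup>2" for n
    by (metis abs_ge_zero power2_abs power_mono)
  have "summable (\<lambda>n. (\<Sum>i\<le>n. norm (c i) * \<bar>a (n - i)\<bar>)\<^sup>2)"
    by (rule summable_convolution_square[OF c(1)])
       (use summable_square_gchoose[OF d] in \<open>simp_all add: a_def power_mult_distrib flip: power_mult\<close>)
  then show ?thesis
    by (rule summable_comparison_test'[where N=0]) (use * in simp)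
qed

subsection \<open>Series of independent square integrable variables\<close>

lemma integrable_mult_square:
  fixes f g :: "'a \<Rightarrow> real"
  assumes [measurable]: "f \<in> borel_measurable M" "g \<in> borel_measurable M"
    and "integrable M (\<lambda>x. (f x)\<^sup>2)" "integrable M (\<lambda>x. (g x)\<^sup>2)"
  shows "integrable M (\<lambda>x. f x * g x)"
proof (rule Bochner_Integration.integrable_bound)
  show "integrable M (\<lambda>x. (f x)\<^sup>2 + (g x)\<^sup>2)"
    using assms by simp
  have "norm (a * b) \<le> norm (a\<^sup>2 + b\<^sup>2)" for a b :: real
  proof -
    have "2 * (\<bar>a\<bar> * \<bar>b\<bar>) \<le> a\<^sup>2 + b\<^sup>2"
      using sum_squares_bound[of "\<bar>a\<bar>" "\<bar>b\<bar>"] by simp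
    moreover have "0 \<le> \<bar>a\<bar> * \<bar>b\<bar>" by simp
    ultimately show ?thesis unfolding real_norm_def abs_mult by linarith
  qed
  then show "AE x in M. norm (f x * g x) \<le> norm ((f x)\<^sup>2 + (g x)\<^sup>2)" by simp
qed measurable

lemma integrable_square_add:
  fixes f g :: "'a \<Rightarrow> real"
  assumes [measurable]: "f \<in> borel_measurable M" "g \<in> borel_measurable M"
    and "integrable M (\<lambda>x. (f x)\<^sup>2)" "integrable M (\<lambda>x. (g x)\<^sup>2)"
  shows "integrable M (\<lambda>x. (f x + g x)\<^sup>2)"
  using assms integrable_mult_square[OF assms] by (simp add: power2_sum mult.assoc)

lemma integrable_square_diff:
  fixes f g :: "'a \<Rightarrow> real"
  assumes "f \<in> borel_measurable M" "g \<in> borel_measurable M"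
    and "integrable M (\<lambda>x. (f x)\<^sup>2)" "integrable M (\<lambda>x. (g x)\<^sup>2)"
  shows "integrable M (\<lambda>x. (f x - g x)\<^sup>2)"
  using assms integrable_mult_square[OF assms] by (simp add: power2_diff mult.assoc)

lemma integrable_square_sum:
  fixes f :: "'i \<Rightarrow> 'a \<Rightarrow> real"
  assumes "\<And>i. i \<in> I \<Longrightarrow> f i \<in> borel_measurable M"
    and "\<And>i. i \<in> I \<Longrightarrow> integrable M (\<lambda>x. (f i x)\<^sup>2)"
  shows "integrable M (\<lambda>x. (\<Sum>i\<in>I. f i x)\<^sup>2)"
  using assms
proof (induction I rule: infinite_finite_induct)
  case (insert i I)
  then show ?case by (simp add: integrable_square_add)
qed auto

text \<open>The polynomial \<open>F - 2 * t * G + t\<^sup>2 * H\<close> in t is the integral of a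
  square. Its minimiser \<open>G / H\<close> gives the inequality; if \<open>H = 0\<close>, the
  polynomial is affine and \<open>t = (F + 1) / (2 * G)\<close> would give it the value -1.\<close>

lemma Cauchy_Schwarz_integral:
  fixes f g :: "'a \<Rightarrow> real"
  assumes [measurable]: "f \<in> borel_measurable M" "g \<in> borel_measurable M"
    and f: "integrable M (\<lambda>x. (f x)\<^sup>2)" and g: "integrable M (\<lambda>x. (g x)\<^sup>2)"
  shows "(\<integral>x. f x * g x \<partial>M)\<^sup>2 \<le> (\<integral>x. (f x)\<^sup>2 \<partial>M) * (\<integral>x. (g x)\<^sup>2 \<partial>M)"
proof -
  define F G H where "F = (\<integral>x. (f x)\<^sup>2 \<partial>M)" and "G = (\<integral>x. f x * g x \<partial>M)" and "H = (\<integral>x. (g x)\<^sup>2 \<partial>M)"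
  have fg: "integrable M (\<lambda>x. f x * g x)" by (rule integrable_mult_square) (use assms in auto)
  have *: "0 \<le> F - 2 * t * G + t\<^sup>2 * H" for t
  proof -
    have "0 \<le> (\<integral>x. (f x - t * g x)\<^sup>2 \<partial>M)" by simp
    also have "\<dots> = (\<integral>x. (f x)\<^sup>2 - 2 * t * (f x * g x) + t\<^sup>2 * (g x)\<^sup>2 \<partial>M)"
      by (intro Bochner_Integration.integral_cong) (auto simp: power2_diff power_mult_distrib)
    also have "\<dots> = F - 2 * t * G + t\<^sup>2 * H"
      using f g fg by (simp add: F_def G_def H_def)
    finally show ?thesis .
  qed
  have "0 \<le> H" by (simp add: H_def)
  then consider "H = 0" | "H > 0" by linarith
  then have "G\<^sup>2 \<le> F * H"
  proof cases
    case 1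
    have "G = 0"
    proof (rule ccontr)
      assume "G \<noteq> 0"
      with *[of "(F + 1) / (2 * G)"] 1 show False by simp
    qed
    then show ?thesis using 1 by simp
  next
    case 2
    with *[of "G / H"] show ?thesis
      by (simp add: field_simps power2_eq_square)
  qed
  then show ?thesis by (simp add: F_def G_def H_def)
qed

context prob_space
begin

text \<open>Serves to read the two-sided noise backwards from a given time and to pass to tails of a
  sequence. Injectivity ensures that no variable is listed twice.\<close>

lemma indep_vars_reindex:
  assumes "indep_vars N X I" "inj_on f J" "f ` J \<subseteq> I"
  shows "indep_vars (\<lambda>j. N (f j)) (\<lambda>j. X (f j)) J"
  unfolding indep_vars_def
proof (intro conjI ballI indep_setsI)
  show "random_variable (N (f j)) (X (f j))" if "j \<in> J" for j
    using assms that by (auto simp: indep_vars_def)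
  let ?F = "\<lambda>i. sigma_sets (space M) {X i -` A \<inter> space M |A. A \<in> sets (N i)}"
  have F: "indep_sets ?F I" using assms(1) by (simp add: indep_vars_def)
  show "?F (f j) \<subseteq> events" if "j \<in> J" for j
    using F assms(3) that by (auto simp: indep_sets_def)
  fix A K assume K: "K \<noteq> {}" "K \<subseteq> J" "finite K" and A: "\<forall>j\<in>K. A j \<in> ?F (f j)"
  have inj: "inj_on f K" using assms(2) K(2) by (rule inj_on_subset)
  have inv: "inv_into K f (f j) = j" if "j \<in> K" for j using inj that by simp
  have "prob (\<Inter>i\<in>f ` K. A (inv_into K f i)) = (\<Prod>i\<in>f ` K. prob (A (inv_into K f i)))"
    by (rule indep_setsD[OF F]) (use K A assms(3) inv in auto)
  then show "prob (\<Inter>j\<in>K. A j) = (\<Prod>j\<in>K. prob (A j))"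
    by (simp add: prod.reindex[OF inj] inv)
qed

end

locale indep_L2_seq = prob_space M for M :: "'a measure" +
  fixes Y :: "nat \<Rightarrow> 'a \<Rightarrow> real"
  assumes indep: "indep_vars (\<lambda>_. borel) Y UNIV"
    and square_integrable: "\<And>k. integrable M (\<lambda>x. (Y k x)\<^sup>2)"
    and mean_zero: "\<And>k. expectation (Y k) = 0"
begin

lemma measurable_Y [measurable]: "Y k \<in> borel_measurable M"
  using indep by (simp add: indep_vars_def)

lemma integrable_Y: "integrable M (Y k)"
  by (rule square_integrable_imp_integrable[OF _ square_integrable]) simp

lemma shift: "indep_L2_seq M (\<lambda>k. Y (m + k))"
  by unfold_locales
    (use indep_vars_reindex[OF indep, of "\<lambda>k. m + k" UNIV] square_integrable mean_zero in auto)

lemma square_integrable_sum: "integrable M (\<lambda>x. (\<Sum>k\<in>K. Y k x)\<^sup>2)"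
  by (rule integrable_square_sum) (auto simp: square_integrable)

text \<open>The martingale difference property without conditional expectations. The past enters as
  a function \<open>f\<close> of the restricted path, so that independence of disjoint blocks of
  coordinates applies; the maximal inequality uses a stopped partial sum for it.\<close>

lemma expectation_mult_past_future:
  assumes [measurable]: "f \<in> borel_measurable (PiM {..<j} (\<lambda>_. borel))"
    and f: "integrable M (\<lambda>x. f (restrict (\<lambda>i. Y i x) {..<j}))"
    and K: "finite K" "K \<subseteq> {j..}"
  shows "expectation (\<lambda>x. f (restrict (\<lambda>i. Y i x) {..<j}) * (\<Sum>k\<in>K. Y k x)) = 0"
proof -
  have "indep_var (PiM {..<j} (\<lambda>_. borel)) (\<lambda>x. restrict (\<lambda>i. Y i x) {..<j})
      (PiM K (\<lambda>_. borel)) (\<lambda>x. restrict (\<lambda>i. Y i x) K)"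
    by (rule indep_var_restrict[OF indep]) (use K in auto)
  from indep_var_compose[OF this, of f borel "\<lambda>g. \<Sum>k\<in>K. g k" borel]
  have "indep_var borel (\<lambda>x. f (restrict (\<lambda>i. Y i x) {..<j})) borel (\<lambda>x. \<Sum>k\<in>K. Y k x)"
    by (simp add: comp_def)
  from indep_var_lebesgue_integral[OF this f] integrable_Y
  have "expectation (\<lambda>x. f (restrict (\<lambda>i. Y i x) {..<j}) * (\<Sum>k\<in>K. Y k x)) =
      expectation (\<lambda>x. f (restrict (\<lambda>i. Y i x) {..<j})) * expectation (\<lambda>x. \<Sum>k\<in>K. Y k x)"
    by simp
  also have "expectation (\<lambda>x. \<Sum>k\<in>K. Y k x) = 0"
    using integrable_Y mean_zero by simp
  finally show ?thesis by (simp only: mult_zero_right)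
qed

lemma expectation_square_sum:
  "expectation (\<lambda>x. (\<Sum>k<n. Y k x)\<^sup>2) = (\<Sum>k<n. expectation (\<lambda>x. (Y k x)\<^sup>2))"
proof (induction n)
  case (Suc n)
  have int: "integrable M (\<lambda>x. (\<Sum>k<n. Y k x) * Y n x)"
    by (rule integrable_mult_square) (auto simp: square_integrable square_integrable_sum)
  have "expectation (\<lambda>x. (\<Sum>k<n. Y k x) * Y n x) = 0"
    using expectation_mult_past_future[of "\<lambda>g. \<Sum>k<n. g k" n "{n}"] integrable_Y by simp
  then show ?case
    using Suc int by (simp add: power2_sum mult.assoc square_integrable square_integrable_sum)
qed simp

text \<open>The event is split according to the first index at which the partial sums leave the
  interval; the increments after that index are orthogonal to everything before it.\<close>

lemma Kolmogorov_maximal_ineq: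
  assumes "\<epsilon> > 0"
  shows "\<epsilon>\<^sup>2 * prob {x \<in> space M. \<exists>n\<le>N. \<epsilon> \<le> \<bar>\<Sum>k<n. Y k x\<bar>} \<le> (\<Sum>k<N. expectation (\<lambda>x. (Y k x)\<^sup>2))"
proof -
  define S where "S n x = (\<Sum>k<n. Y k x)" for n x
  define P where "P j x \<longleftrightarrow> \<epsilon> \<le> \<bar>S j x\<bar> \<and> (\<forall>i<j. \<bar>S i x\<bar> < \<epsilon>)" for j x
  define A where "A j = {x \<in> space M. P j x}" for j
  have [measurable]: "S n \<in> borel_measurable M" for n
    unfolding S_def[abs_def] by measurable
  have [measurable]: "A j \<in> events" for j
    unfolding A_def P_def by measurable
  have S2: "integrable M (\<lambda>x. (S n x)\<^sup>2)" for n
    unfolding S_def by (rule square_integrable_sum)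
  have IS2: "integrable M (\<lambda>x. indicator (A j) x * (S n x)\<^sup>2)" for j n
    using integrable_mult_indicator[OF _ S2, of "A j" n] by simp
  have disj: "disjoint_family A"
    unfolding disjoint_family_on_def A_def P_def by (auto simp: not_less) (metis linorder_neqE_nat not_less)
  have step: "\<epsilon>\<^sup>2 * prob (A j) \<le> expectation (\<lambda>x. indicator (A j) x * (S N x)\<^sup>2)" if "j \<le> N" for j
  proof -
    \<comment> \<open>The indicator of \<open>A j\<close> times \<open>S j\<close>, rewritten as a
      function of the first \<open>j\<close> variables: the partial sums up to index
      \<open>j\<close> use no others.\<close>
    define f where "f g = (if \<epsilon> \<le> \<bar>\<Sum>k<j. g k\<bar> \<and> (\<forall>i<j. \<bar>\<Sum>k<i. g k\<bar> < \<epsilon>) then \<Sum>k<j. g k else (0::real))" for g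
    have f: "f (restrict (\<lambda>i. Y i x) {..<j}) = indicator (A j) x * S j x" if "x \<in> space M" for x
      using that by (auto simp: f_def A_def P_def S_def indicator_def)
    have [measurable]: "f \<in> borel_measurable (PiM {..<j} (\<lambda>_. borel))"
    proof -
      have [measurable]: "(\<lambda>g. \<Sum>k<i. g k :: real) \<in> borel_measurable (PiM {..<j} (\<lambda>_. borel))" if "i \<le> j" for i
        by (intro borel_measurable_sum measurable_component_singleton) (use that in auto)
      show ?thesis unfolding f_def[abs_def] by measurable
    qed
    have split: "S N x = S j x + (\<Sum>k=j..<N. Y k x)" for x
      unfolding S_def using that
      by (metis sum.atLeastLessThan_concat atLeast0LessThan le0)
    have ISj: "integrable M (\<lambda>x. indicator (A j) x * S j x)"
      using integrable_mult_indicator[OF _ square_integrable_imp_integrable[OF _ S2], of "A j" j] by simp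
    have "expectation (\<lambda>x. indicator (A j) x * S j x * (\<Sum>k=j..<N. Y k x)) =
        expectation (\<lambda>x. f (restrict (\<lambda>i. Y i x) {..<j}) * (\<Sum>k=j..<N. Y k x))"
      by (intro Bochner_Integration.integral_cong) (auto simp: f)
    also have "\<dots> = 0"
    proof (rule expectation_mult_past_future)
      show "integrable M (\<lambda>x. f (restrict (\<lambda>i. Y i x) {..<j}))"
        by (subst Bochner_Integration.integrable_cong[OF refl f]) (auto simp: ISj)
    qed auto
    finally have cross: "expectation (\<lambda>x. indicator (A j) x * S j x * (\<Sum>k=j..<N. Y k x)) = 0" .
    have ISj2: "integrable M (\<lambda>x. (indicator (A j) x * S j x)\<^sup>2)"
      using IS2[of j j] by (rule Bochner_Integration.integrable_cong[THEN iffD1, rotated -1]) (auto simp: indicator_def)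
    have crossi: "integrable M (\<lambda>x. indicator (A j) x * S j x * (\<Sum>k=j..<N. Y k x))"
      by (rule integrable_mult_square) (use ISj2 square_integrable_sum in auto)
    have "\<epsilon>\<^sup>2 * prob (A j) = expectation (\<lambda>x. \<epsilon>\<^sup>2 * indicator (A j) x)" by simp
    also have "\<dots> \<le> expectation (\<lambda>x. indicator (A j) x * (S j x)\<^sup>2)"
    proof (rule integral_mono)
      fix x assume "x \<in> space M"
      show "\<epsilon>\<^sup>2 * indicator (A j) x \<le> indicator (A j) x * (S j x)\<^sup>2"
        using power_mono[of \<epsilon> "\<bar>S j x\<bar>" 2] assms by (auto simp: indicator_def A_def P_def)
    qed (use IS2 in \<open>auto simp: emeasure_eq_measure\<close>)
    \<comment> \<open>The cross term of mean zero is inserted so that the next inequality holds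
      pointwise: the square of \<open>S N\<close> exceeds this sum, on \<open>A j\<close>, by the
      square of the later increment.\<close>
    also have "\<dots> = expectation (\<lambda>x. indicator (A j) x * (S j x)\<^sup>2 + 2 * (indicator (A j) x * S j x * (\<Sum>k=j..<N. Y k x)))"
      using IS2 crossi cross by simp
    also have "\<dots> \<le> expectation (\<lambda>x. indicator (A j) x * (S N x)\<^sup>2)"
    proof (rule integral_mono)
      fix x show "indicator (A j) x * (S j x)\<^sup>2 + 2 * (indicator (A j) x * S j x * (\<Sum>k=j..<N. Y k x)) \<le>
          indicator (A j) x * (S N x)\<^sup>2"
        unfolding split[of x] by (auto simp: indicator_def power2_sum)
    qed (use IS2 crossi in auto)
    finally show ?thesis .
  qed
  have ex: "{x \<in> space M. \<exists>n\<le>N. \<epsilon> \<le> \<bar>\<Sum>k<n. Y k x\<bar>} = (\<Union>j\<le>N. A j)"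
  proof safe
    fix x n assume x: "x \<in> space M" and "n \<le> N" "\<epsilon> \<le> \<bar>\<Sum>k<n. Y k x\<bar>"
    then have *: "\<epsilon> \<le> \<bar>S n x\<bar>" by (simp add: S_def)
    obtain j where j: "\<epsilon> \<le> \<bar>S j x\<bar>" "\<forall>i<j. \<not> \<epsilon> \<le> \<bar>S i x\<bar>"
      using exists_least_iff[of "\<lambda>j. \<epsilon> \<le> \<bar>S j x\<bar>"] * by blast
    then have "P j x" by (auto simp: P_def not_le)
    moreover have "j \<le> N"
      using j(2) * \<open>n \<le> N\<close> by (metis le_trans not_less)
    ultimately show "x \<in> (\<Union>j\<le>N. A j)" using x by (auto simp: A_def)
  qed (auto simp: A_def P_def S_def)
  have "\<epsilon>\<^sup>2 * prob (\<Union>j\<le>N. A j) = (\<Sum>j\<le>N. \<epsilon>\<^sup>2 * prob (A j))"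
    using disj
    by (subst finite_measure_finite_Union) (auto simp: sum_distrib_left disjoint_family_on_def)
  also have "\<dots> \<le> (\<Sum>j\<le>N. expectation (\<lambda>x. indicator (A j) x * (S N x)\<^sup>2))"
    by (intro sum_mono step) auto
  also have "\<dots> = expectation (\<lambda>x. \<Sum>j\<le>N. indicator (A j) x * (S N x)\<^sup>2)"
    by (intro Bochner_Integration.integral_sum[symmetric] IS2)
  also have "\<dots> \<le> expectation (\<lambda>x. (S N x)\<^sup>2)"
  proof (rule integral_mono)
    fix x
    have "(\<Sum>j\<le>N. indicator (A j) x :: real) \<le> 1"
    proof (cases "\<exists>j\<le>N. x \<in> A j")
      case True
      then obtain j where j: "j \<le> N" "x \<in> A j" by blast
      then have "(\<Sum>i\<le>N. indicator (A i) x :: real) = (\<Sum>i\<le>N. if i = j then 1 else 0)"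
        using disj by (intro sum.cong) (auto simp: disjoint_family_on_def indicator_def)
      then show ?thesis by simp
    qed (simp add: indicator_def)
    then show "(\<Sum>j\<le>N. indicator (A j) x * (S N x)\<^sup>2) \<le> (S N x)\<^sup>2"
      unfolding sum_distrib_right[symmetric] by (intro mult_left_le_one_le sum_nonneg) auto
  qed (rule Bochner_Integration.integrable_sum, rule IS2, rule S2)
  also have "\<dots> = (\<Sum>k<N. expectation (\<lambda>x. (Y k x)\<^sup>2))"
    unfolding S_def by (rule expectation_square_sum)
  finally show ?thesis unfolding ex .
qed

text \<open>The finite bounds are uniform in \<open>N\<close> and the events increase with
  \<open>N\<close>, so continuity from below passes them to the whole infinite sequence of partial
  sums.\<close>

lemma Kolmogorov_maximal_ineq_infinite:
  assumes "\<epsilon> > 0" and summ: "summable (\<lambda>k. expectation (\<lambda>x. (Y k x)\<^sup>2))"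
  shows "\<epsilon>\<^sup>2 * prob {x \<in> space M. \<exists>n. \<epsilon> \<le> \<bar>\<Sum>k<n. Y k x\<bar>} \<le> (\<Sum>k. expectation (\<lambda>x. (Y k x)\<^sup>2))"
proof -
  define B where "B N = {x \<in> space M. \<exists>n\<le>N. \<epsilon> \<le> \<bar>\<Sum>k<n. Y k x\<bar>}" for N
  have [measurable]: "B N \<in> events" for N
    unfolding B_def by measurable
  have "(\<lambda>N. prob (B N)) \<longlonglongrightarrow> prob (\<Union>N. B N)"
    by (rule finite_Lim_measure_incseq) (auto simp: incseq_def B_def intro: order_trans)
  moreover have "(\<Union>N. B N) = {x \<in> space M. \<exists>n. \<epsilon> \<le> \<bar>\<Sum>k<n. Y k x\<bar>}"
    by (auto simp: B_def)
  ultimately have "(\<lambda>N. \<epsilon>\<^sup>2 * prob (B N)) \<longlonglongrightarrow> \<epsilon>\<^sup>2 * prob {x \<in> space M. \<exists>n. \<epsilon> \<le> \<bar>\<Sum>k<n. Y k x\<bar>}"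
    by (simp add: tendsto_mult_left)
  moreover have "\<epsilon>\<^sup>2 * prob (B N) \<le> (\<Sum>k. expectation (\<lambda>x. (Y k x)\<^sup>2))" for N
  proof -
    have "\<epsilon>\<^sup>2 * prob (B N) \<le> (\<Sum>k<N. expectation (\<lambda>x. (Y k x)\<^sup>2))"
      unfolding B_def by (rule Kolmogorov_maximal_ineq) fact
    also have "\<dots> \<le> (\<Sum>k. expectation (\<lambda>x. (Y k x)\<^sup>2))"
      by (rule sum_le_suminf) (auto simp: summ)
    finally show ?thesis .
  qed
  ultimately show ?thesis
    by (intro LIMSEQ_le_const2) auto
qed

end

section \<open>Almost sure and mean square convergence of the series\<close>

locale summable_indep_L2_seq = indep_L2_seq +
  assumes summable_variance: "summable (\<lambda>k. expectation (\<lambda>x. (Y k x)\<^sup>2))"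
begin

definition tail_variance :: "nat \<Rightarrow> real" where
  "tail_variance m = (\<Sum>k. expectation (\<lambda>x. (Y (m + k) x)\<^sup>2))"

lemma tail_variance_tendsto_0: "tail_variance \<longlonglongrightarrow> 0"
proof -
  have "tail_variance m = suminf (\<lambda>k. expectation (\<lambda>x. (Y k x)\<^sup>2)) - (\<Sum>k<m. expectation (\<lambda>x. (Y k x)\<^sup>2))" for m
    unfolding tail_variance_def using suminf_minus_initial_segment[OF summable_variance, of m]
    by (simp add: add.commute)
  then have "tail_variance = (\<lambda>m. suminf (\<lambda>k. expectation (\<lambda>x. (Y k x)\<^sup>2)) - (\<Sum>k<m. expectation (\<lambda>x. (Y k x)\<^sup>2)))"
    by auto
  moreover have "\<dots> \<longlonglongrightarrow> suminf (\<lambda>k. expectation (\<lambda>x. (Y k x)\<^sup>2)) - suminf (\<lambda>k. expectation (\<lambda>x. (Y k x)\<^sup>2))"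
    by (intro tendsto_intros summable_LIMSEQ summable_variance)
  ultimately show ?thesis by simp
qed

lemma sum_shift: "(\<Sum>k<m + n. Y k x) - (\<Sum>k<m. Y k x) = (\<Sum>k<n. Y (m + k) x)"
  by (induction n) auto

lemma summable_variance_shift: "summable (\<lambda>k. expectation (\<lambda>x. (Y (m + k) x)\<^sup>2))"
  using summable_ignore_initial_segment[OF summable_variance, of m] by (simp add: add.commute)

text \<open>For fixed r, the event that after every m the partial sums still move away by at least
  1/(r+1) has probability at most (r+1)^2 times \<open>tail_variance m\<close>, for every m, hence
  zero. Off these countably many null events the partial sums are Cauchy.\<close>

lemma AE_summable: "AE x in M. summable (\<lambda>k. Y k x)"
proof -
  define D where "D r m = {x \<in> space M. \<exists>n. 1 / real (Suc r) \<le> \<bar>\<Sum>k<n. Y (m + k) x\<bar>}" for r m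
  have [measurable]: "D r m \<in> events" for r m
    unfolding D_def by measurable
  have "AE x in M. x \<notin> (\<Inter>m. D r m)" for r
  proof -
    have bound: "prob (\<Inter>m. D r m) \<le> (real (Suc r))\<^sup>2 * tail_variance m" for m
    proof -
      interpret sh: indep_L2_seq M "\<lambda>k. Y (m + k)" by (rule shift)
      have "(1 / real (Suc r))\<^sup>2 * prob (D r m) \<le> tail_variance m"
        unfolding D_def tail_variance_def
        by (rule sh.Kolmogorov_maximal_ineq_infinite) (auto simp: summable_variance_shift)
      then have "prob (D r m) \<le> (real (Suc r))\<^sup>2 * tail_variance m"
        by (simp add: field_simps del: of_nat_Suc)
      moreover have "prob (\<Inter>m. D r m) \<le> prob (D r m)"
        by (rule finite_measure_mono) auto
      ultimately show ?thesis by linarith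
    qed
    have "(\<lambda>m. (real (Suc r))\<^sup>2 * tail_variance m) \<longlonglongrightarrow> (real (Suc r))\<^sup>2 * 0"
      by (intro tendsto_intros tail_variance_tendsto_0)
    then have "prob (\<Inter>m. D r m) \<le> (real (Suc r))\<^sup>2 * 0"
      by (rule LIMSEQ_le_const) (use bound in blast)
    then have "prob (\<Inter>m. D r m) = 0"
      by (simp add: measure_le_0_iff)
    then show ?thesis
      by (subst prob_eq_0[symmetric]) auto
  qed
  then have "AE x in M. \<forall>r. x \<notin> (\<Inter>m. D r m)"
    by (simp add: AE_all_countable)
  then show ?thesis
  proof (rule AE_mp, intro AE_I2 impI)
    fix x assume x: "x \<in> space M" "\<forall>r. x \<notin> (\<Inter>m. D r m)"
    have "Cauchy (\<lambda>n. \<Sum>k<n. Y k x)"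
    proof (rule metric_CauchyI)
      fix e :: real assume "e > 0"
      \<comment> \<open>Half of \<open>e\<close>, because two late partial sums are compared through
        the one at index m.\<close>
      obtain r where r: "1 / real (Suc r) < e / 2"
        using \<open>e > 0\<close> nat_approx_posE[of "e / 2"] by auto
      obtain m where m: "\<And>n. \<bar>\<Sum>k<n. Y (m + k) x\<bar> < 1 / real (Suc r)"
        using x by (auto simp: D_def not_le simp del: of_nat_Suc)
      have near: "\<bar>(\<Sum>k<a. Y k x) - (\<Sum>k<m. Y k x)\<bar> < e / 2" if "m \<le> a" for a
        using sum_shift[where m=m and n="a - m" and x=x] m[of "a - m"] r that by simp
      have "dist (\<Sum>k<a. Y k x) (\<Sum>k<b. Y k x) < e" if "m \<le> a" "m \<le> b" for a b
        using near[OF that(1)] near[OF that(2)] unfolding dist_real_def by linarith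
      then show "\<exists>m. \<forall>a\<ge>m. \<forall>b\<ge>m. dist (\<Sum>k<a. Y k x) (\<Sum>k<b. Y k x) < e"
        by blast
    qed
    then show "summable (\<lambda>k. Y k x)"
      by (simp add: Cauchy_convergent_iff summable_iff_convergent)
  qed
qed

definition total :: "'a \<Rightarrow> real" where "total x = (\<Sum>k. Y k x)"

lemma measurable_total [measurable]: "total \<in> borel_measurable M"
  unfolding total_def[abs_def] by measurable

text \<open>Stated for the nonnegative integral because integrability of the limit is a consequence.
  By orthogonality every finite increment after \<open>n\<close> has second moment at most
  \<open>tail_variance n\<close>, a bound that survives the lower limit; the case
  \<open>n = 0\<close> makes \<open>total\<close> square integrable.\<close>

lemma nn_integral_remainder_le:
  "(\<integral>\<^sup>+x. ennreal ((total x - (\<Sum>k<n. Y k x))\<^sup>2) \<partial>M) \<le> ennreal (tail_variance n)"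
proof -
  interpret sh: indep_L2_seq M "\<lambda>k. Y (n + k)" by (rule shift)
  define u where "u m x = ennreal ((\<Sum>k<m. Y (n + k) x)\<^sup>2)" for m x
  have [measurable]: "u m \<in> borel_measurable M" for m
    unfolding u_def[abs_def] by measurable
  have "AE x in M. ennreal ((total x - (\<Sum>k<n. Y k x))\<^sup>2) = liminf (\<lambda>m. u m x)"
    using AE_summable
  proof eventually_elim
    case (elim x)
    have "(\<lambda>m. (\<Sum>k<n + m. Y k x)) \<longlonglongrightarrow> total x"
      unfolding total_def using LIMSEQ_ignore_initial_segment[OF summable_LIMSEQ[OF elim], of n]
      by (simp add: add.commute)
    then have "(\<lambda>m. (\<Sum>k<n + m. Y k x) - (\<Sum>k<n. Y k x)) \<longlonglongrightarrow> total x - (\<Sum>k<n. Y k x)"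
      by (intro tendsto_intros)
    then have "(\<lambda>m. u m x) \<longlonglongrightarrow> ennreal ((total x - (\<Sum>k<n. Y k x))\<^sup>2)"
      unfolding sum_shift u_def by (intro tendsto_ennrealI tendsto_power)
    then show ?case
      by (simp add: lim_imp_Liminf)
  qed
  then have "(\<integral>\<^sup>+x. ennreal ((total x - (\<Sum>k<n. Y k x))\<^sup>2) \<partial>M) = (\<integral>\<^sup>+x. liminf (\<lambda>m. u m x) \<partial>M)"
    by (rule nn_integral_cong_AE)
  also have "\<dots> \<le> liminf (\<lambda>m. integral\<^sup>N M (u m))"
    by (rule nn_integral_liminf) measurable
  also have "\<dots> \<le> ennreal (tail_variance n)"
  proof (rule Liminf_le)
    have "integral\<^sup>N M (u m) \<le> ennreal (tail_variance n)" for m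
    proof -
      have "integral\<^sup>N M (u m) = ennreal (expectation (\<lambda>x. (\<Sum>k<m. Y (n + k) x)\<^sup>2))"
        unfolding u_def by (rule nn_integral_eq_integral) (use sh.square_integrable_sum in auto)
      also have "\<dots> = ennreal (\<Sum>k<m. expectation (\<lambda>x. (Y (n + k) x)\<^sup>2))"
        by (simp add: sh.expectation_square_sum)
      also have "\<dots> \<le> ennreal (tail_variance n)"
        unfolding tail_variance_def
        by (intro ennreal_leI sum_le_suminf summable_variance_shift) auto
      finally show ?thesis .
    qed
    then show "\<forall>\<^sub>F m in sequentially. integral\<^sup>N M (u m) \<le> ennreal (tail_variance n)"
      by simp
  qed simp
  finally show ?thesis .
qed

lemma tail_variance_nonneg: "0 \<le> tail_variance n"
  unfolding tail_variance_def by (intro suminf_nonneg summable_variance_shift) auto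

lemma square_integrable_remainder: "integrable M (\<lambda>x. (total x - (\<Sum>k<n. Y k x))\<^sup>2)"
  by (rule integrableI_bounded)
     (use nn_integral_remainder_le[of n] in \<open>auto simp: le_less_trans[OF _ ennreal_less_top]\<close>)

lemma expectation_remainder_le: "expectation (\<lambda>x. (total x - (\<Sum>k<n. Y k x))\<^sup>2) \<le> tail_variance n"
proof -
  have "ennreal (expectation (\<lambda>x. (total x - (\<Sum>k<n. Y k x))\<^sup>2)) \<le> ennreal (tail_variance n)"
    using nn_integral_remainder_le[of n]
    by (subst nn_integral_eq_integral[symmetric]) (auto simp: square_integrable_remainder)
  then show ?thesis
    using tail_variance_nonneg by (simp add: ennreal_le_iff)
qed

lemma square_integrable_total: "integrable M (\<lambda>x. (total x)\<^sup>2)"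
  using square_integrable_remainder[of 0] by simp

text \<open>By Cauchy-Schwarz the squared error of the n-th partial sum is at most
  \<open>tail_variance n\<close> times the second moment of \<open>V\<close>. The choice of
  \<open>V\<close> then yields the mean of the series (\<open>V\<close> constant 1), its correlation
  with a noise term, or with another such series.\<close>

lemma sums_expectation_mult:
  assumes [measurable]: "V \<in> borel_measurable M" and V: "integrable M (\<lambda>x. (V x)\<^sup>2)"
  shows "(\<lambda>k. expectation (\<lambda>x. Y k x * V x)) sums expectation (\<lambda>x. total x * V x)"
proof -
  define R where "R n = expectation (\<lambda>x. (total x - (\<Sum>k<n. Y k x)) * V x)" for n
  have YV: "integrable M (\<lambda>x. Y k x * V x)" for k
    by (rule integrable_mult_square) (auto simp: square_integrable V)
  have TV: "integrable M (\<lambda>x. total x * V x)"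
    by (rule integrable_mult_square) (auto simp: square_integrable_total V)
  have R: "(\<Sum>k<n. expectation (\<lambda>x. Y k x * V x)) = expectation (\<lambda>x. total x * V x) - R n" for n
    unfolding R_def using YV TV by (simp add: left_diff_distrib sum_distrib_right)
  have le: "(R n)\<^sup>2 \<le> tail_variance n * expectation (\<lambda>x. (V x)\<^sup>2)" for n
  proof -
    have "(R n)\<^sup>2 \<le> expectation (\<lambda>x. (total x - (\<Sum>k<n. Y k x))\<^sup>2) * expectation (\<lambda>x. (V x)\<^sup>2)"
      unfolding R_def by (rule Cauchy_Schwarz_integral) (auto simp: square_integrable_remainder V)
    also have "\<dots> \<le> tail_variance n * expectation (\<lambda>x. (V x)\<^sup>2)"
      by (intro mult_right_mono expectation_remainder_le) auto
    finally show ?thesis .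
  qed
  have "(\<lambda>n. tail_variance n * expectation (\<lambda>x. (V x)\<^sup>2)) \<longlonglongrightarrow> 0"
    using tendsto_mult_left_zero[OF tail_variance_tendsto_0] by simp
  from tendsto_sandwich[OF always_eventually always_eventually tendsto_const this, where g="\<lambda>n. (R n)\<^sup>2"]
  have "(\<lambda>n. (R n)\<^sup>2) \<longlonglongrightarrow> 0"
    using le by simp
  then have "(\<lambda>n. sqrt ((R n)\<^sup>2)) \<longlonglongrightarrow> sqrt 0"
    by (rule tendsto_real_sqrt)
  then have "R \<longlonglongrightarrow> 0"
    by (simp add: tendsto_rabs_zero_iff)
  then have "(\<lambda>n. expectation (\<lambda>x. total x * V x) - R n) \<longlonglongrightarrow> expectation (\<lambda>x. total x * V x) - 0"
    by (intro tendsto_intros)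
  then show ?thesis
    unfolding sums_def R by simp
qed

end

subsection \<open>Ergodicity of the Bernoulli shift\<close>

locale two_sided_product = prob_space N for N :: "real measure" +
  assumes sets_N [measurable_cong]: "sets N = sets borel"
begin

sublocale P: product_prob_space "\<lambda>_. N" "UNIV :: int set"
  by unfold_locales

abbreviation P :: "(int \<Rightarrow> real) measure" where
  "P \<equiv> PiM UNIV (\<lambda>_. N)"

abbreviation shift :: "int \<Rightarrow> (int \<Rightarrow> real) \<Rightarrow> int \<Rightarrow> real" where
  "shift h z \<equiv> (\<lambda>t. z (t + h))"

lemma space_N [simp]: "space N = UNIV"
  using sets_eq_imp_space_eq[OF sets_N] by simp

lemma space_P [simp]: "space P = UNIV"
  by (simp add: space_PiM)

lemma sets_P: "sets P = sets (PiM UNIV (\<lambda>_. borel))"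
  by (rule sets_PiM_cong) (auto simp: sets_N)

lemma measurable_shift [measurable]: "shift h \<in> measurable P P"
  by (rule measurable_PiM_single') (auto intro: measurable_component_singleton)

lemma distr_shift: "distr P P (shift h) = P"
  using distr_PiM_reindex[of UNIV "\<lambda>_. N" "\<lambda>t::int. t + h" UNIV] prob_space_axioms
  by (simp add: inj_on_def restrict_def)

lemma measure_shift:
  assumes "A \<in> sets P"
  shows "measure P (shift h -` A) = measure P A"
  using measure_distr[of "shift h" P P A] assms by (simp add: distr_shift)

text \<open>The index set is an argument because independence and the effect of a translation are
  read off from it, while the event lives on the full path space, so cylinders over different index
  sets can be compared.\<close>

definition cylinder :: "int set \<Rightarrow> (int \<Rightarrow> real) set \<Rightarrow> bool" where
  "cylinder J C \<longleftrightarrow> finite J \<and> (\<exists>D \<in> sets (PiM J (\<lambda>_. N)). C = (\<lambda>z. restrict z J) -` D)"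

lemma cylinderI:
  assumes "finite J" "D \<in> sets (PiM J (\<lambda>_. N))"
  shows "cylinder J ((\<lambda>z. restrict z J) -` D)"
  using assms by (auto simp: cylinder_def)

lemma cylinder_sets: "cylinder J C \<Longrightarrow> C \<in> sets P"
  unfolding cylinder_def
  by (auto intro!: measurable_sets[of "\<lambda>z. restrict z J" P "PiM J (\<lambda>_. N)", simplified] measurable_restrict_subset)

lemma cylinder_extend:
  assumes "cylinder J C" "J \<subseteq> K" "finite K"
  shows "cylinder K C"
proof -
  obtain D where D: "D \<in> sets (PiM J (\<lambda>_. N))" "C = (\<lambda>z. restrict z J) -` D"
    using assms(1) by (auto simp: cylinder_def)
  have "(\<lambda>z. restrict z J) \<in> measurable (PiM K (\<lambda>_. N)) (PiM J (\<lambda>_. N))"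
    by (rule measurable_restrict_subset) fact
  from measurable_sets[OF this D(1)]
  have "(\<lambda>z. restrict z J) -` D \<inter> space (PiM K (\<lambda>_. N)) \<in> sets (PiM K (\<lambda>_. N))" .
  moreover have "C = (\<lambda>z. restrict z K) -` ((\<lambda>z. restrict z J) -` D \<inter> space (PiM K (\<lambda>_. N)))"
  proof (rule set_eqI)
    fix z :: "int \<Rightarrow> real"
    have "restrict (restrict z K) J = restrict z J"
      using assms(2) by (simp add: Int_absorb1)
    then show "z \<in> C \<longleftrightarrow> z \<in> (\<lambda>z. restrict z K) -` ((\<lambda>z. restrict z J) -` D \<inter> space (PiM K (\<lambda>_. N)))"
      by (simp add: D(2) space_PiM)
  qed
  ultimately show ?thesis
    using cylinderI[OF assms(3)] by metis
qed

lemma cylinder_Compl: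
  assumes "cylinder J C" shows "cylinder J (- C)"
proof -
  obtain D where D: "D \<in> sets (PiM J (\<lambda>_. N))" "C = (\<lambda>z. restrict z J) -` D" "finite J"
    using assms by (auto simp: cylinder_def)
  have "- C = (\<lambda>z. restrict z J) -` (space (PiM J (\<lambda>_. N)) - D)"
    by (auto simp: D space_PiM)
  then show ?thesis using cylinderI[OF D(3)] D(1) by (metis sets.compl_sets)
qed

lemma cylinder_Un:
  assumes "cylinder J C" "cylinder J C'" shows "cylinder J (C \<union> C')"
proof -
  obtain D D' where D: "D \<in> sets (PiM J (\<lambda>_. N))" "C = (\<lambda>z. restrict z J) -` D" "finite J"
     "D' \<in> sets (PiM J (\<lambda>_. N))" "C' = (\<lambda>z. restrict z J) -` D'"
    using assms by (auto simp: cylinder_def)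
  have "C \<union> C' = (\<lambda>z. restrict z J) -` (D \<union> D')"
    by (auto simp: D)
  then show ?thesis using cylinderI[OF D(3)] D by (metis sets.Un)
qed

section \<open>Approximation of events by cylinders, and ergodicity\<close>

definition approximable :: "(int \<Rightarrow> real) set \<Rightarrow> bool" where
  "approximable A \<longleftrightarrow> A \<in> sets P \<and> (\<forall>e>0. \<exists>J C. cylinder J C \<and> measure P (sym_diff A C) < e)"

lemma approximable_Un:
  assumes "approximable A" "approximable B" shows "approximable (A \<union> B)"
  unfolding approximable_def
proof (intro conjI allI impI)
  show AB: "A \<union> B \<in> sets P" using assms by (auto simp: approximable_def)
  fix e :: real assume "e > 0"
  then have "e / 2 > 0" by simp
  then obtain J C K D where C: "cylinder J C" "measure P (sym_diff A C) < e / 2"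
    and D: "cylinder K D" "measure P (sym_diff B D) < e / 2"
    using assms unfolding approximable_def by meson
  have [measurable]: "A \<in> sets P" "B \<in> sets P" "C \<in> sets P" "D \<in> sets P"
    using assms C D cylinder_sets by (auto simp: approximable_def)
  have "finite (J \<union> K)" using C(1) D(1) by (auto simp: cylinder_def)
  then have "cylinder (J \<union> K) (C \<union> D)"
    by (intro cylinder_Un cylinder_extend[OF C(1)] cylinder_extend[OF D(1)]) auto
  moreover have "measure P (sym_diff (A \<union> B) (C \<union> D)) < e"
  proof -
    have "measure P (sym_diff (A \<union> B) (C \<union> D)) \<le> measure P (sym_diff A C \<union> sym_diff B D)"
      by (rule P.finite_measure_mono) auto
    also have "\<dots> \<le> measure P (sym_diff A C) + measure P (sym_diff B D)"
      by (rule measure_Un_le) auto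
    finally show ?thesis using C D by linarith
  qed
  ultimately show "\<exists>J C'. cylinder J C' \<and> measure P (sym_diff (A \<union> B) C') < e"
    by blast
qed

lemma approximable_empty: "approximable {}"
proof -
  have "cylinder {} {}" by (auto simp: cylinder_def)
  then show ?thesis unfolding approximable_def by force
qed

text \<open>The approximable events contain the coordinate events and are closed under complement,
  which leaves symmetric differences unchanged. For a countable union, continuity from below
  replaces it by a finite one at the cost of e/2, and the finite union is approximated with the
  other half.\<close>

lemma approximable_sets:
  assumes "A \<in> sets P"
  shows "approximable A"
proof -
  have "A \<in> sigma_sets UNIV {{f. f i \<in> B} |i B. B \<in> sets N}"
    using assms by (simp add: sets_PiM_single PiE_UNIV_domain)
  then show ?thesis
  proof induction
    case (Basic A)
    then obtain i B where A: "A = {f. f i \<in> B}" and [measurable]: "B \<in> sets N" by auto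
    let ?D = "{f \<in> space (PiM {i} (\<lambda>_. N)). f i \<in> B}"
    have "?D \<in> sets (PiM {i} (\<lambda>_. N))"
      using measurable_sets[OF measurable_component_singleton[of i "{i}" "\<lambda>_. N"] \<open>B \<in> sets N\<close>]
      by (simp add: vimage_def Int_def conj_commute)
    moreover have "A = (\<lambda>z. restrict z {i}) -` ?D"
      by (intro set_eqI) (simp add: A space_PiM)
    ultimately have "cylinder {i} A"
      using cylinderI[of "{i}" ?D] by simp
    then show ?case
      unfolding approximable_def using cylinder_sets by force
  next
    case Empty
    show ?case by (rule approximable_empty)
  next
    case (Compl A)
    show ?case
      unfolding approximable_def
    proof (intro conjI allI impI)
      show "UNIV - A \<in> sets P" using Compl.IH by (auto simp: approximable_def sets.compl_sets[of _ P, simplified])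
      fix e :: real assume "e > 0"
      then obtain J C where C: "cylinder J C" "measure P (sym_diff A C) < e"
        using Compl.IH unfolding approximable_def by meson
      have "sym_diff (UNIV - A) (- C) = sym_diff A C" by auto
      then show "\<exists>J C. cylinder J C \<and> measure P (sym_diff (UNIV - A) C) < e"
        using C cylinder_Compl by metis
    qed
  next
    case (Union A)
    have A[measurable]: "A n \<in> sets P" for n using Union.IH by (auto simp: approximable_def)
    have fin: "approximable (\<Union>i<n. A i)" for n :: nat
      by (induction n) (auto simp: approximable_empty lessThan_Suc intro!: approximable_Un Union.IH)
    show ?case
      unfolding approximable_def
    proof (intro conjI allI impI)
      show "(\<Union>i. A i) \<in> sets P" by measurable
      fix e :: real assume "e > 0"
      have "(\<lambda>n. measure P (\<Union>i<n. A i)) \<longlonglongrightarrow> measure P (\<Union>n. \<Union>i<n. A i)"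
        by (rule P.finite_Lim_measure_incseq) (auto simp: incseq_def intro: order_less_le_trans)
      also have "(\<Union>n. \<Union>i<n. A i) = (\<Union>i. A i)" by auto
      finally have "\<forall>\<^sub>F n in sequentially. measure P (\<Union>i. A i) - e / 2 < measure P (\<Union>i<n. A i)"
        by (rule order_tendstoD) (use \<open>e > 0\<close> in auto)
      then obtain n where n: "measure P (\<Union>i. A i) - e / 2 < measure P (\<Union>i<n. A i)"
        by (auto simp: eventually_sequentially)
      obtain J C where C: "cylinder J C" "measure P (sym_diff (\<Union>i<n. A i) C) < e / 2"
        using fin[of n] \<open>e > 0\<close> unfolding approximable_def by (meson half_gt_zero)
      have [measurable]: "C \<in> sets P" using C cylinder_sets by auto
      have "measure P (sym_diff (\<Union>i. A i) C) \<le> measure P (((\<Union>i. A i) - (\<Union>i<n. A i)) \<union> sym_diff (\<Union>i<n. A i) C)"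
        by (rule P.finite_measure_mono) auto
      also have "\<dots> \<le> measure P ((\<Union>i. A i) - (\<Union>i<n. A i)) + measure P (sym_diff (\<Union>i<n. A i) C)"
        by (rule measure_Un_le) auto
      also have "measure P ((\<Union>i. A i) - (\<Union>i<n. A i)) = measure P (\<Union>i. A i) - measure P (\<Union>i<n. A i)"
        by (rule P.finite_measure_Diff) auto
      finally have "measure P (sym_diff (\<Union>i. A i) C) < e" using n C by linarith
      then show "\<exists>J C. cylinder J C \<and> measure P (sym_diff (\<Union>i. A i) C) < e"
        using C by blast
    qed
  qed
qed

lemma indep_vars_coordinates: "P.indep_vars (\<lambda>_. N) (\<lambda>t z. z t) UNIV"
proof (subst P.indep_vars_iff_distr_eq_PiM)
  show "distr P (PiM UNIV (\<lambda>i. N)) (\<lambda>z. \<lambda>i\<in>UNIV. z i) = PiM UNIV (\<lambda>i. distr P N (\<lambda>z. z i))"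
    by (simp add: P.PiM_component restrict_def)
qed auto

lemma measure_cylinder_Int:
  assumes "cylinder J C" "cylinder K D" "J \<inter> K = {}"
  shows "measure P (C \<inter> D) = measure P C * measure P D"
proof -
  obtain C' D' where C': "C' \<in> sets (PiM J (\<lambda>_. N))" "C = (\<lambda>z. restrict z J) -` C'"
     and D': "D' \<in> sets (PiM K (\<lambda>_. N))" "D = (\<lambda>z. restrict z K) -` D'"
    using assms by (auto simp: cylinder_def)
  have "P.indep_var (PiM J (\<lambda>_. N)) (\<lambda>z. restrict (\<lambda>t. z t) J) (PiM K (\<lambda>_. N)) (\<lambda>z. restrict (\<lambda>t. z t) K)"
    by (rule P.indep_var_restrict[OF indep_vars_coordinates]) (use assms in auto)
  from P.indep_varD[OF this C'(1) D'(1)]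
  show ?thesis unfolding C'(2) D'(2) by (simp add: vimage_def Int_def Collect_conj_eq[symmetric])
qed

text \<open>\<open>shift h z\<close> reads \<open>z\<close> at \<open>t + h\<close>, so the preimage
  depends on the coordinates moved forward by \<open>h\<close>.\<close>

lemma cylinder_shift:
  assumes "cylinder J C"
  shows "cylinder ((\<lambda>t. t + h) ` J) (shift h -` C)"
proof -
  obtain D where D: "D \<in> sets (PiM J (\<lambda>_. N))" "C = (\<lambda>z. restrict z J) -` D" and J: "finite J"
    using assms by (auto simp: cylinder_def)
  let ?K = "(\<lambda>t. t + h) ` J"
  have "(\<lambda>z. \<lambda>t\<in>J. z (t + h)) \<in> measurable (PiM ?K (\<lambda>_. N)) (PiM J (\<lambda>_. N))"
    by (intro measurable_restrict measurable_component_singleton) auto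
  from measurable_sets[OF this D(1)]
  have "(\<lambda>z. \<lambda>t\<in>J. z (t + h)) -` D \<inter> space (PiM ?K (\<lambda>_. N)) \<in> sets (PiM ?K (\<lambda>_. N))" .
  moreover have "shift h -` C = (\<lambda>z. restrict z ?K) -` ((\<lambda>z. \<lambda>t\<in>J. z (t + h)) -` D \<inter> space (PiM ?K (\<lambda>_. N)))"
  proof -
    have *: "(\<lambda>t\<in>J. restrict z ?K (t + h)) = (\<lambda>t\<in>J. z (t + h))" for z :: "int \<Rightarrow> real"
      by (intro restrict_ext) (simp add: image_iff)
    have "restrict z ?K \<in> space (PiM ?K (\<lambda>_. N))" for z :: "int \<Rightarrow> real"
      by (simp add: space_PiM)
    then show ?thesis unfolding D(2) by (intro set_eqI) (simp only: vimage_eq Int_iff * simp_thms)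
  qed
  ultimately show ?thesis
    using cylinderI[OF finite_imageI[OF J]] by metis
qed

lemma ergodic_shift:
  assumes A: "A \<in> sets P" and inv: "shift 1 -` A = A"
  shows "measure P A \<in> {0, 1}"
proof -
  have invn: "shift (int n) -` A = A" for n
  proof (induction n)
    case (Suc n)
    have "shift (int (Suc n)) -` A = shift (int n) -` (shift 1 -` A)"
      by (auto simp: algebra_simps)
    then show ?case using Suc inv by simp
  qed simp
  define a where "a = measure P A"
  have a: "0 \<le> a" "a \<le> 1" by (auto simp: a_def)
  have "\<bar>a - a * a\<bar> \<le> e" if "e > 0" for e :: real
  proof -
    \<comment> \<open>The budget e/4: \<open>C\<close> and its translate each miss \<open>A\<close>
      by less than e/4, which costs e/2 in the comparison of \<open>a\<close> with the square of the
      measure of \<open>C\<close>; replacing that square by \<open>a * a\<close> costs less than 2 *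
      e/4.\<close>
    obtain J C where C: "cylinder J C" and Ce: "measure P (sym_diff A C) < e / 4"
      using approximable_sets[OF A] \<open>e > 0\<close> unfolding approximable_def by (meson divide_pos_pos zero_less_numeral)
    have [measurable]: "A \<in> sets P" "C \<in> sets P" using A C cylinder_sets by auto
    have "finite J" using C by (simp add: cylinder_def)
    define b where "b = Max (insert 0 (abs ` J))"
    have b: "\<bar>t\<bar> \<le> b" if "t \<in> J" for t
      unfolding b_def using \<open>finite J\<close> that by (intro Max_ge) auto
    \<comment> \<open>\<open>J\<close> lies in the interval from -b to b, so a translation by more
      than 2b makes it disjoint from its image.\<close>
    define n where "n = nat (2 * \<bar>b\<bar> + 1)"
    define C' where "C' = shift (int n) -` C"
    have C': "cylinder ((\<lambda>t. t + int n) ` J) C'"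
      unfolding C'_def by (rule cylinder_shift[OF C])
    then have [measurable]: "C' \<in> sets P" by (rule cylinder_sets)
    have "J \<inter> (\<lambda>t. t + int n) ` J = {}"
    proof (rule ccontr)
      assume "J \<inter> (\<lambda>t. t + int n) ` J \<noteq> {}"
      then obtain t where "t \<in> J" "t + int n \<in> J" by blast
      with b[of t] b[of "t + int n"] show False by (simp add: n_def)
    qed
    then have "measure P (C \<inter> C') = measure P C * measure P C'"
      by (rule measure_cylinder_Int[OF C C'])
    also have "measure P C' = measure P C"
      unfolding C'_def by (rule measure_shift) measurable
    finally have CC': "measure P (C \<inter> C') = measure P C * measure P C" .
    \<comment> \<open>Here invariance of \<open>A\<close> enters: its symmetric difference with the
      translate is the preimage of the one with \<open>C\<close>.\<close>
    have "measure P (sym_diff A C') = measure P (shift (int n) -` sym_diff A C)"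
      unfolding C'_def vimage_Un vimage_Diff invn ..
    also have "\<dots> = measure P (sym_diff A C)"
      by (rule measure_shift) measurable
    finally have Ce': "measure P (sym_diff A C') < e / 4" using Ce by simp
    have diff: "\<bar>measure P U - measure P V\<bar> \<le> measure P (sym_diff U V)"
      if [measurable]: "U \<in> sets P" "V \<in> sets P" for U V
    proof -
      have "measure P U \<le> measure P (V \<union> sym_diff U V)" "measure P V \<le> measure P (U \<union> sym_diff U V)"
        by (auto intro!: P.finite_measure_mono)
      moreover have "measure P (V \<union> sym_diff U V) \<le> measure P V + measure P (sym_diff U V)"
          "measure P (U \<union> sym_diff U V) \<le> measure P U + measure P (sym_diff U V)"
        by (auto intro!: measure_Un_le)
      ultimately show ?thesis by linarith
    qed
    have "\<bar>a - measure P (C \<inter> C')\<bar> \<le> measure P (sym_diff A (C \<inter> C'))"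
      unfolding a_def by (rule diff) measurable
    also have "\<dots> \<le> measure P (sym_diff A C \<union> sym_diff A C')"
      by (rule P.finite_measure_mono) auto
    also have "\<dots> \<le> measure P (sym_diff A C) + measure P (sym_diff A C')"
      by (rule measure_Un_le) auto
    finally have 1: "\<bar>a - measure P C * measure P C\<bar> < e / 2" using Ce Ce' CC' by simp
    define c where "c = measure P C"
    have c: "0 \<le> c" "c \<le> 1" by (auto simp: c_def)
    have ac: "\<bar>a - c\<bar> < e / 4" using diff[of A C] Ce by (simp add: a_def c_def)
    have "\<bar>a * a - c * c\<bar> = \<bar>a - c\<bar> * (a + c)"
      using a c by (simp add: square_diff_square_factored abs_mult)
    also have "\<dots> \<le> \<bar>a - c\<bar> * 2" using a c by (intro mult_left_mono) auto
    also have "\<dots> < e / 2" using ac by simp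
    finally have 2: "\<bar>a * a - c * c\<bar> < e / 2" .
    have "\<bar>a - a * a\<bar> \<le> \<bar>a - c * c\<bar> + \<bar>a * a - c * c\<bar>"
      using abs_triangle_ineq4[of "a - c * c" "a * a - c * c"] by simp
    then show ?thesis using 1 2 unfolding c_def by linarith
  qed
  then have "\<bar>a - a * a\<bar> \<le> 0" by (rule field_le_epsilon[where y=0, simplified])
  then have "a * (1 - a) = 0" by (simp add: algebra_simps)
  then show ?thesis by (simp add: a_def)
qed

end

subsection \<open>Measurable factors of i.i.d. sequences\<close>

context prob_space
begin

lemma indep_var_of_indep_vars:
  assumes "indep_vars N X I" "i \<in> I" "j \<in> I" "i \<noteq> j"
  shows "indep_var (N i) (X i) (N j) (X j)"
proof -
  have "indep_var (PiM {i} N) (\<lambda>x. restrict (\<lambda>k. X k x) {i}) (PiM {j} N) (\<lambda>x. restrict (\<lambda>k. X k x) {j})"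
    by (rule indep_var_restrict[OF assms(1)]) (use assms in auto)
  from indep_var_compose[OF this measurable_component_singleton[of i] measurable_component_singleton[of j]]
  show ?thesis by (simp add: comp_def)
qed

lemma measurable_path:
  fixes Y :: "int \<Rightarrow> 'a \<Rightarrow> real"
  assumes "\<And>t. Y t \<in> borel_measurable M" "sets P = sets (PiM UNIV (\<lambda>_. borel))"
  shows "(\<lambda>x t. Y t x) \<in> measurable M P"
proof -
  have "(\<lambda>x t. Y t x) \<in> measurable M (PiM UNIV (\<lambda>_. borel))"
    by (rule measurable_PiM_single') (use assms in auto)
  then show ?thesis by (simp cong: measurable_cong_sets add: assms(2))
qed

text \<open>The exceptional null set in \<open>Y_eq\<close> may depend on t. Finitely many are
  merged for the finite-dimensional laws and countably many for the whole path; after that, both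
  claims concern only the product measure \<open>P\<close>, the law of the noise path.\<close>

lemma
  fixes Z Y :: "int \<Rightarrow> 'a \<Rightarrow> real" and F :: "(int \<Rightarrow> real) \<Rightarrow> real"
  assumes Z_indep: "indep_vars (\<lambda>_. borel) Z UNIV"
    and Z_ident: "\<And>t. distr M borel (Z t) = distr M borel (Z 0)"
    and F: "F \<in> borel_measurable (PiM UNIV (\<lambda>_. borel))"
    and Y [measurable]: "\<And>t. Y t \<in> borel_measurable M"
    and Y_eq: "\<And>t. AE x in M. Y t x = F (\<lambda>s. Z (s + t) x)"
  shows strictly_stationary_iid_factor: "strictly_stationary M Y"
    and ergodic_iid_factor: "ergodic M Y"
proof -
  have Z [measurable]: "Z t \<in> borel_measurable M" for t
    using Z_indep by (simp add: indep_vars_def)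
  define N where "N = distr M borel (Z 0)"
  interpret N: prob_space N unfolding N_def by (rule prob_space_distr) simp
  interpret two_sided_product N by unfold_locales (simp add: N_def)
  have F' [measurable]: "F \<in> borel_measurable P"
    using F by (simp cong: measurable_cong_sets add: sets_P)
  define path where "path x = (\<lambda>t. Z t x)" for x
  have path [measurable]: "path \<in> measurable M P"
    unfolding path_def[abs_def] by (rule measurable_path) (auto simp: sets_P)
  have law: "distr M P path = P"
  proof -
    have "distr M (PiM UNIV (\<lambda>_. borel)) (\<lambda>x. \<lambda>t\<in>UNIV. Z t x) = PiM UNIV (\<lambda>t. distr M borel (Z t))"
      using indep_vars_iff_distr_eq_PiM[where I=UNIV and M'="\<lambda>_. borel" and X=Z] Z_indep by simp
    moreover have "distr M P path = distr M (PiM UNIV (\<lambda>_. borel)) (\<lambda>x. \<lambda>t\<in>UNIV. Z t x)"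
      by (rule distr_cong) (auto simp: sets_P path_def)
    moreover have "distr M borel (Z t) = N" for t
      unfolding N_def by (rule Z_ident)
    ultimately show ?thesis by simp
  qed
  have Y_eq': "AE x in M. Y t x = F (shift t (path x))" for t
    using Y_eq[of t] by (simp add: path_def)
  show "strictly_stationary M Y"
    unfolding strictly_stationary_def
  proof (intro conjI allI impI)
    fix J :: "int set" and h :: int assume J: "finite J"
    have G [measurable]: "(\<lambda>z. \<lambda>j\<in>J. F (shift (j + h) z)) \<in> measurable P (PiM J (\<lambda>_. borel))" for h
      by (intro measurable_restrict) measurable
    have *: "distr M (PiM J (\<lambda>_. borel)) (\<lambda>x. \<lambda>j\<in>J. Y (j + h) x) =
        distr P (PiM J (\<lambda>_. borel)) (\<lambda>z. \<lambda>j\<in>J. F (shift (j + h) z))" for h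
    proof -
      have "AE x in M. \<forall>j\<in>J. Y (j + h) x = F (shift (j + h) (path x))"
        using J Y_eq' by (intro AE_finite_allI)
      then have "AE x in M. (\<lambda>j\<in>J. Y (j + h) x) = (\<lambda>j\<in>J. F (shift (j + h) (path x)))"
        by eventually_elim (auto intro!: restrict_ext)
      then have "distr M (PiM J (\<lambda>_. borel)) (\<lambda>x. \<lambda>j\<in>J. Y (j + h) x) =
          distr M (PiM J (\<lambda>_. borel)) (\<lambda>x. \<lambda>j\<in>J. F (shift (j + h) (path x)))"
        by (intro distr_cong_AE measurable_restrict) (auto intro: measurable_compose[OF path])
      also have "\<dots> = distr (distr M P path) (PiM J (\<lambda>_. borel)) (\<lambda>z. \<lambda>j\<in>J. F (shift (j + h) z))"
        by (subst distr_distr[OF G path]) (simp add: comp_def)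
      finally show ?thesis by (simp only: law)
    qed
    \<comment> \<open>Moving the time index by \<open>h\<close> amounts to moving the noise path by
      \<open>h\<close>, which preserves \<open>P\<close>. The form \<open>j + 0\<close> makes the
      right-hand side an instance of \<open>G\<close>.\<close>
    have "distr P (PiM J (\<lambda>_. borel)) (\<lambda>z. \<lambda>j\<in>J. F (shift (j + h) z)) =
        distr P (PiM J (\<lambda>_. borel)) ((\<lambda>z. \<lambda>j\<in>J. F (shift (j + 0) z)) \<circ> shift h)"
      by (simp add: comp_def add.assoc add.commute[of h])
    also have "\<dots> = distr (distr P P (shift h)) (PiM J (\<lambda>_. borel)) (\<lambda>z. \<lambda>j\<in>J. F (shift (j + 0) z))"
      by (rule distr_distr[symmetric, OF G measurable_shift])
    also have "\<dots> = distr P (PiM J (\<lambda>_. borel)) (\<lambda>z. \<lambda>j\<in>J. F (shift (j + 0) z))"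
      by (simp only: distr_shift)
    finally show "distr M (PiM J (\<lambda>_. borel)) (\<lambda>x. \<lambda>j\<in>J. Y (j + h) x) =
        distr M (PiM J (\<lambda>_. borel)) (\<lambda>x. \<lambda>j\<in>J. Y j x)"
      using *[of h] *[of 0] by simp
  qed simp
  show "ergodic M Y"
    unfolding ergodic_def
  proof (intro ballI impI)
    fix A :: "(int \<Rightarrow> real) set"
    assume A [measurable]: "A \<in> sets (PiM UNIV (\<lambda>_. borel))" and inv: "{f. (\<lambda>t. f (t + 1)) \<in> A} = A"
    \<comment> \<open>\<open>\<Phi>\<close> sends a noise path to the full path of the factor
      process. It commutes with the shift, so the preimage of an invariant event is
      invariant.\<close>
    define \<Phi> where "\<Phi> z = (\<lambda>t. F (shift t z))" for z
    have \<Phi> [measurable]: "\<Phi> \<in> measurable P (PiM UNIV (\<lambda>_. borel))"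
      unfolding \<Phi>_def[abs_def] by (rule measurable_PiM_single') auto
    have \<Phi>A: "\<Phi> -` A \<in> sets P"
      using measurable_sets[OF \<Phi> A] by simp
    have Ypath [measurable]: "(\<lambda>x t. Y t x) \<in> measurable M (PiM UNIV (\<lambda>_. borel))"
      by (rule measurable_path) auto
    have "AE x in M. \<forall>t. Y t x = F (shift t (path x))"
      using Y_eq' by (simp add: AE_all_countable)
    then have "AE x in M. (\<lambda>t. Y t x) = \<Phi> (path x)"
      by eventually_elim (simp add: \<Phi>_def)
    then have "measure M {x \<in> space M. (\<lambda>t. Y t x) \<in> A} = measure M {x \<in> space M. \<Phi> (path x) \<in> A}"
      by (intro finite_measure_eq_AE) auto
    also have "\<dots> = measure M (path -` (\<Phi> -` A) \<inter> space M)"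
      by (auto intro: arg_cong[where f="measure M"])
    also have "\<dots> = measure (distr M P path) (\<Phi> -` A)"
      by (rule measure_distr[symmetric, OF path \<Phi>A])
    also have "\<dots> = measure P (\<Phi> -` A)" by (simp only: law)
    finally have eq: "measure M {x \<in> space M. (\<lambda>t. Y t x) \<in> A} = measure P (\<Phi> -` A)" .
    have "\<Phi> (shift 1 z) = shift 1 (\<Phi> z)" for z
      by (simp add: \<Phi>_def add.assoc add.commute[of 1])
    then have "shift 1 -` (\<Phi> -` A) = \<Phi> -` {f. (\<lambda>t. f (t + 1)) \<in> A}"
      by (simp add: vimage_def)
    then have "shift 1 -` (\<Phi> -` A) = \<Phi> -` A" by (simp only: inv)
    from ergodic_shift[OF \<Phi>A this]
    show "measure M {x \<in> space M. (\<lambda>t. Y t x) \<in> A} \<in> {0, 1}"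
      by (simp only: eq)
  qed
qed

end

lemma covar_commute: "covar M U V = covar M V U"
  by (simp add: covar_def mult.commute)

subsection \<open>FIEGARCH processes\<close>

locale fiegarch_L2 = fiegarch +
  assumes log_sq_moment: "(\<integral>\<^sup>+x. e2ennreal ((ext_log_sq (Z 0) x)\<^sup>2) \<partial>M) < \<infinity>"
    and d_less_half: "d < 1 / 2"
begin

lemma measurable_Z [measurable]: "Z t \<in> borel_measurable M"
  using Z_indep by (simp add: indep_vars_def)

lemma Z_ident_integrable:
  fixes f :: "real \<Rightarrow> real"
  assumes [measurable]: "f \<in> borel_measurable borel" and f: "integrable M (\<lambda>x. f (Z 0 x))"
  shows "integrable M (\<lambda>x. f (Z t x))"
proof -
  have "integrable (distr M borel (Z 0)) f" using f by (simp add: integrable_distr_eq)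
  then have "integrable (distr M borel (Z t)) f" by (simp only: Z_ident[of t])
  then show ?thesis by (simp add: integrable_distr_eq)
qed

lemma Z_ident_expectation:
  fixes f :: "real \<Rightarrow> real"
  assumes [measurable]: "f \<in> borel_measurable borel"
  shows "expectation (\<lambda>x. f (Z t x)) = expectation (\<lambda>x. f (Z 0 x))"
proof -
  have "expectation (\<lambda>x. f (Z s x)) = integral\<^sup>L (distr M borel (Z s)) f" for s
    by (simp add: integral_distr)
  then show ?thesis by (simp only: Z_ident[of t])
qed

lemma Z_ident_AE:
  assumes [measurable]: "Measurable.pred borel Q" and Q: "AE x in M. Q (Z 0 x)"
  shows "AE x in M. Q (Z t x)"
proof -
  have "AE r in distr M borel (Z 0). Q r" using Q by (subst AE_distr_iff) auto
  then have "AE r in distr M borel (Z t). Q r" by (simp only: Z_ident[of t])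
  then show ?thesis by (subst (asm) AE_distr_iff) auto
qed

lemma lam_square_summable: "summable (\<lambda>k. (lam k)\<^sup>2)"
  using fractional_coeffs_square_summable[OF beta_nonzero d_less_half lam_expansion] .

lemma lam_mult_summable: "summable (\<lambda>k. lam k * lam (k + n))"
proof (rule summable_comparison_test'[where N=0])
  show "summable (\<lambda>k. (lam k)\<^sup>2 + (lam (k + n))\<^sup>2)"
    by (intro summable_add lam_square_summable summable_ignore_initial_segment[OF lam_square_summable])
  fix k
  have "2 * (\<bar>lam k\<bar> * \<bar>lam (k + n)\<bar>) \<le> (lam k)\<^sup>2 + (lam (k + n))\<^sup>2"
    using sum_squares_bound[of "\<bar>lam k\<bar>" "\<bar>lam (k + n)\<bar>"] by simp
  moreover have "0 \<le> \<bar>lam k\<bar> * \<bar>lam (k + n)\<bar>" by simp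
  ultimately show "norm (lam k * lam (k + n)) \<le> (lam k)\<^sup>2 + (lam (k + n))\<^sup>2"
    unfolding real_norm_def abs_mult by linarith
qed

text \<open>In \<open>news\<close> the centring constant is recomputed from the distribution of the
  argument. Fixing it at its value for \<open>Z 0\<close> gives a single Borel function of the noise
  value, as independence and the factor representation require.\<close>

definition innov :: "real \<Rightarrow> real" where
  "innov r = \<theta> * r + \<gamma> * (\<bar>r\<bar> - expectation (\<lambda>x. \<bar>Z 0 x\<bar>))"

lemma measurable_innov [measurable]: "innov \<in> borel_measurable borel"
  unfolding innov_def[abs_def] by measurable

lemma news_eq: "news M \<theta> \<gamma> (Z t) = (\<lambda>x. innov (Z t x))"
  using Z_ident_expectation[of abs t] by (simp add: news_def innov_def)

definition innov_var :: real where
  "innov_var = \<theta>\<^sup>2 + \<gamma>\<^sup>2 - (\<gamma> * expectation (\<lambda>x. \<bar>Z 0 x\<bar>))\<^sup>2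
     + 2 * \<theta> * \<gamma> * expectation (\<lambda>x. Z 0 x * \<bar>Z 0 x\<bar>)"

lemma expectation_Z_square: "expectation (\<lambda>x. (Z 0 x)\<^sup>2) = 1"
  using Z_variance Z_mean by simp

lemma integrable_Z_mult_abs: "integrable M (\<lambda>x. Z 0 x * \<bar>Z 0 x\<bar>)"
  by (rule integrable_mult_square) (auto simp: Z_integrable)

lemma square_integrable_innov: "integrable M (\<lambda>x. (innov (Z t x))\<^sup>2)"
proof (rule Z_ident_integrable)
  have "integrable M (\<lambda>x. (\<theta> * Z 0 x + \<gamma> * (\<bar>Z 0 x\<bar> - expectation (\<lambda>x. \<bar>Z 0 x\<bar>)))\<^sup>2)"
  proof (rule integrable_square_add)
    show "integrable M (\<lambda>x. (\<gamma> * (\<bar>Z 0 x\<bar> - expectation (\<lambda>x. \<bar>Z 0 x\<bar>)))\<^sup>2)"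
      unfolding power_mult_distrib
      by (intro integrable_mult_right integrable_square_diff) (auto simp: Z_integrable)
  qed (auto simp: Z_integrable power_mult_distrib)
  then show "integrable M (\<lambda>x. (innov (Z 0 x))\<^sup>2)" by (simp add: innov_def)
qed measurable

lemma integrable_innov: "integrable M (\<lambda>x. innov (Z t x))"
  by (rule square_integrable_imp_integrable[OF _ square_integrable_innov]) simp

lemma expectation_innov: "expectation (\<lambda>x. innov (Z t x)) = 0"
proof -
  have "expectation (\<lambda>x. innov (Z t x)) = expectation (\<lambda>x. innov (Z 0 x))"
    by (rule Z_ident_expectation) simp
  also have "\<dots> = 0"
    using Z_integrable Z_mean by (simp add: innov_def prob_space)
  finally show ?thesis .
qed

text \<open>With c the mean of the absolute noise, mean 0 removes the term linear in
  \<open>Z 0\<close>, variance 1 turns both squares into \<theta>^2 + \<gamma>^2, and the constants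
  -2 \<gamma>^2 c^2 and \<gamma>^2 c^2 combine to the negative term of
  \<open>innov_var\<close>.\<close>

lemma expectation_innov_square: "expectation (\<lambda>x. (innov (Z t x))\<^sup>2) = innov_var"
proof -
  define c where "c = expectation (\<lambda>x. \<bar>Z 0 x\<bar>)"
  have "expectation (\<lambda>x. (innov (Z t x))\<^sup>2) = expectation (\<lambda>x. (innov (Z 0 x))\<^sup>2)"
    by (rule Z_ident_expectation) simp
  also have "\<dots> = expectation (\<lambda>x. (\<theta>\<^sup>2 + \<gamma>\<^sup>2) * (Z 0 x)\<^sup>2 + 2 * \<theta> * \<gamma> * (Z 0 x * \<bar>Z 0 x\<bar>)
      - 2 * \<theta> * \<gamma> * c * Z 0 x - 2 * \<gamma>\<^sup>2 * c * \<bar>Z 0 x\<bar> + \<gamma>\<^sup>2 * c\<^sup>2)"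
  proof (rule Bochner_Integration.integral_cong[OF refl])
    fix x
    have "(\<theta> * z + \<gamma> * (y - c))\<^sup>2 = \<theta>\<^sup>2 * z\<^sup>2 + \<gamma>\<^sup>2 * y\<^sup>2 + 2 * \<theta> * \<gamma> * (z * y)
        - 2 * \<theta> * \<gamma> * c * z - 2 * \<gamma>\<^sup>2 * c * y + \<gamma>\<^sup>2 * c\<^sup>2" for y z
      by (simp add: power2_eq_square algebra_simps)
    from this[of "Z 0 x" "\<bar>Z 0 x\<bar>"]
    show "(innov (Z 0 x))\<^sup>2 = (\<theta>\<^sup>2 + \<gamma>\<^sup>2) * (Z 0 x)\<^sup>2 + 2 * \<theta> * \<gamma> * (Z 0 x * \<bar>Z 0 x\<bar>)
      - 2 * \<theta> * \<gamma> * c * Z 0 x - 2 * \<gamma>\<^sup>2 * c * \<bar>Z 0 x\<bar> + \<gamma>\<^sup>2 * c\<^sup>2"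
      by (simp add: innov_def c_def[symmetric] distrib_right)
  qed
  also have "\<dots> = (\<theta>\<^sup>2 + \<gamma>\<^sup>2) * expectation (\<lambda>x. (Z 0 x)\<^sup>2) + 2 * \<theta> * \<gamma> * expectation (\<lambda>x. Z 0 x * \<bar>Z 0 x\<bar>)
      - 2 * \<theta> * \<gamma> * c * expectation (Z 0) - 2 * \<gamma>\<^sup>2 * c * c + \<gamma>\<^sup>2 * c\<^sup>2"
    using Z_integrable integrable_Z_mult_abs by (simp add: c_def prob_space)
  also have "\<dots> = innov_var"
    unfolding expectation_Z_square Z_mean innov_var_def c_def[symmetric]
    by (simp add: power2_eq_square algebra_simps)
  finally show ?thesis .
qed

text \<open>Where \<open>Z 0\<close> vanishes the squared extended logarithm is infinite, so a
  finite integral forces this event to be null.\<close>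

lemma Z_nonzero: "AE x in M. Z t x \<noteq> 0"
proof (rule Z_ident_AE)
  define A where "A = {x \<in> space M. Z 0 x = 0}"
  have [measurable]: "A \<in> events" unfolding A_def by measurable
  have "\<infinity> * emeasure M A = (\<integral>\<^sup>+x. \<infinity> * indicator A x \<partial>M)"
    by (simp add: nn_integral_cmult_indicator)
  also have "\<dots> \<le> (\<integral>\<^sup>+x. e2ennreal ((ext_log_sq (Z 0) x)\<^sup>2) \<partial>M)"
    by (intro nn_integral_mono)
       (auto simp: A_def indicator_def ext_log_sq_def ext_ln_def power2_eq_square e2ennreal_infty)
  finally have "\<infinity> * emeasure M A < \<infinity>" using log_sq_moment by (rule le_less_trans)
  then have "emeasure M A = 0"
    by (auto simp: ennreal_top_mult split: if_splits)
  then show "AE x in M. Z 0 x \<noteq> 0"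
    by (subst AE_iff_measurable[of A]) (auto simp: A_def)
qed measurable

definition logZ :: "int \<Rightarrow> 'a \<Rightarrow> real" where
  "logZ t x = ln ((Z t x)\<^sup>2) - expectation (log_sq (Z 0))"

lemma measurable_logZ [measurable]: "logZ t \<in> borel_measurable M"
  unfolding logZ_def[abs_def] by measurable

lemma square_integrable_log_sq: "integrable M (\<lambda>x. (ln ((Z t x)\<^sup>2))\<^sup>2)"
proof (rule Z_ident_integrable)
  \<comment> \<open>Holds at every point: at a zero of \<open>Z 0\<close> the real logarithm is 0 by
    convention and the extended square is infinite; elsewhere the two agree.\<close>
  have "(\<integral>\<^sup>+x. ennreal (norm ((ln ((Z 0 x)\<^sup>2))\<^sup>2)) \<partial>M) \<le> (\<integral>\<^sup>+x. e2ennreal ((ext_log_sq (Z 0) x)\<^sup>2) \<partial>M)"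
    by (intro nn_integral_mono)
       (auto simp: ext_log_sq_def ext_ln_def power2_eq_square)
  also have "\<dots> < \<infinity>" by (rule log_sq_moment)
  finally show "integrable M (\<lambda>x. (ln ((Z 0 x)\<^sup>2))\<^sup>2)"
    by (intro integrableI_bounded) auto
qed measurable

lemma integrable_log_sq: "integrable M (\<lambda>x. ln ((Z t x)\<^sup>2))"
  by (rule square_integrable_imp_integrable[OF _ square_integrable_log_sq]) simp

lemma square_integrable_logZ: "integrable M (\<lambda>x. (logZ t x)\<^sup>2)"
  unfolding logZ_def by (rule integrable_square_diff) (auto simp: square_integrable_log_sq)

lemma expectation_logZ: "expectation (logZ t) = 0"
proof -
  have "expectation (logZ t) = expectation (\<lambda>x. ln ((Z t x)\<^sup>2)) - expectation (log_sq (Z 0))"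
    using integrable_log_sq[of t] by (simp add: logZ_def[abs_def] prob_space)
  also have "expectation (\<lambda>x. ln ((Z t x)\<^sup>2)) = expectation (log_sq (Z 0))"
    unfolding log_sq_def by (rule Z_ident_expectation) simp
  finally show ?thesis by simp
qed

section \<open>Orthogonality of innovations and log-noise at different times\<close>

lemma expectation_mult_indep:
  fixes f g :: "real \<Rightarrow> real"
  assumes [measurable]: "f \<in> borel_measurable borel" "g \<in> borel_measurable borel"
    and "s \<noteq> t" "integrable M (\<lambda>x. f (Z s x))" "integrable M (\<lambda>x. g (Z t x))"
  shows "expectation (\<lambda>x. f (Z s x) * g (Z t x)) = expectation (\<lambda>x. f (Z s x)) * expectation (\<lambda>x. g (Z t x))"
proof -
  have "indep_var borel (Z s) borel (Z t)"
    using indep_var_of_indep_vars[OF Z_indep, of s t] assms(3) by simp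
  from indep_var_compose[OF this assms(1,2)]
  show ?thesis
    using indep_var_lebesgue_integral[of "\<lambda>x. f (Z s x)" "\<lambda>x. g (Z t x)"] assms(4,5)
    by (simp add: comp_def)
qed

lemma expectation_innov_innov:
  "expectation (\<lambda>x. innov (Z s x) * innov (Z t x)) = (if s = t then innov_var else 0)"
  using expectation_mult_indep[of innov innov s t] integrable_innov
  by (auto simp: expectation_innov expectation_innov_square simp flip: power2_eq_square)

lemma expectation_innov_logZ:
  "expectation (\<lambda>x. innov (Z s x) * logZ t x) =
    (if s = t then covar M (news M \<theta> \<gamma> (Z 0)) (log_sq (Z 0)) else 0)"
proof (cases "s = t")
  case True
  have "expectation (\<lambda>x. innov (Z t x) * logZ t x) = expectation (\<lambda>x. innov (Z 0 x) * logZ 0 x)"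
    unfolding logZ_def
    by (rule Z_ident_expectation[where f="\<lambda>r. innov r * (ln (r\<^sup>2) - expectation (log_sq (Z 0)))"]) simp
  also have "\<dots> = covar M (news M \<theta> \<gamma> (Z 0)) (log_sq (Z 0))"
    unfolding covar_def news_eq by (simp add: expectation_innov logZ_def) (simp add: log_sq_def)
  finally show ?thesis using True by simp
next
  case False
  have "expectation (\<lambda>x. innov (Z s x) * logZ t x) = expectation (\<lambda>x. innov (Z s x)) * expectation (logZ t)"
    unfolding logZ_def[abs_def]
    by (rule expectation_mult_indep[where g="\<lambda>r. ln (r\<^sup>2) - expectation (log_sq (Z 0))"])
       (use False integrable_innov integrable_log_sq in auto)
  then show ?thesis using False by (simp add: expectation_innov)
qed

lemma expectation_logZ_logZ:
  "expectation (\<lambda>x. logZ s x * logZ t x) = (if s = t then variance (log_sq (Z 0)) else 0)"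
proof (cases "s = t")
  case True
  have "expectation (\<lambda>x. logZ t x * logZ t x) = expectation (\<lambda>x. logZ 0 x * logZ 0 x)"
    unfolding logZ_def
    by (rule Z_ident_expectation[where f="\<lambda>r. (ln (r\<^sup>2) - expectation (log_sq (Z 0))) * (ln (r\<^sup>2) - expectation (log_sq (Z 0)))"]) simp
  also have "\<dots> = variance (log_sq (Z 0))"
    by (simp add: logZ_def log_sq_def power2_eq_square)
  finally show ?thesis using True by simp
next
  case False
  have "expectation (\<lambda>x. logZ s x * logZ t x) = expectation (logZ s) * expectation (logZ t)"
    unfolding logZ_def[abs_def]
    by (rule expectation_mult_indep[where f="\<lambda>r. ln (r\<^sup>2) - expectation (log_sq (Z 0))"
          and g="\<lambda>r. ln (r\<^sup>2) - expectation (log_sq (Z 0))"])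
       (use False integrable_log_sq in auto)
  then show ?thesis using False by (simp add: expectation_logZ)
qed

section \<open>The series for the log-volatility and its covariances\<close>

lemma summable_indep_innov: "summable_indep_L2_seq M (\<lambda>k x. lam k * innov (Z (t - 1 - int k) x))"
proof (unfold_locales)
  have "indep_vars (\<lambda>_. borel) (\<lambda>k. Z (t - 1 - int k)) UNIV"
    using indep_vars_reindex[OF Z_indep, of "\<lambda>k. t - 1 - int k" UNIV] by (simp add: inj_on_def)
  then show "indep_vars (\<lambda>_. borel) (\<lambda>k x. lam k * innov (Z (t - 1 - int k) x)) UNIV"
    by (rule indep_vars_compose2[where Y="\<lambda>k r. lam k * innov r"]) measurable
  show "integrable M (\<lambda>x. (lam k * innov (Z (t - 1 - int k) x))\<^sup>2)" for k
    by (simp add: power_mult_distrib square_integrable_innov)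
  show "expectation (\<lambda>x. lam k * innov (Z (t - 1 - int k) x)) = 0" for k
    by (simp add: expectation_innov)
  show "summable (\<lambda>k. expectation (\<lambda>x. (lam k * innov (Z (t - 1 - int k) x))\<^sup>2))"
    using summable_mult2[OF lam_square_summable, of innov_var]
    by (simp add: power_mult_distrib expectation_innov_square)
qed

text \<open>Almost surely the log-volatility minus its constant \<omega>, by \<open>sigma_eq\<close>
  and \<open>news_eq\<close>.\<close>

definition vol :: "int \<Rightarrow> 'a \<Rightarrow> real" where
  "vol t x = (\<Sum>k. lam k * innov (Z (t - 1 - int k) x))"

lemma vol_summable: "AE x in M. summable (\<lambda>k. lam k * innov (Z (t - 1 - int k) x))"
  using summable_indep_L2_seq.AE_summable[OF summable_indep_innov] .

lemma measurable_vol [measurable]: "vol t \<in> borel_measurable M"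
  unfolding vol_def[abs_def] by measurable

lemma square_integrable_vol: "integrable M (\<lambda>x. (vol t x)\<^sup>2)"
  using summable_indep_L2_seq.square_integrable_total[OF summable_indep_innov, of t]
  unfolding summable_indep_L2_seq.total_def[OF summable_indep_innov] vol_def .

lemma sums_expectation_vol:
  assumes "V \<in> borel_measurable M" "integrable M (\<lambda>x. (V x)\<^sup>2)"
  shows "(\<lambda>k. lam k * expectation (\<lambda>x. innov (Z (t - 1 - int k) x) * V x)) sums expectation (\<lambda>x. vol t x * V x)"
  using summable_indep_L2_seq.sums_expectation_mult[OF summable_indep_innov assms, of t]
  unfolding summable_indep_L2_seq.total_def[OF summable_indep_innov] vol_def
  by (simp add: mult.assoc)

lemma expectation_vol: "expectation (vol t) = 0"
proof -
  have "(\<lambda>k. 0::real) sums expectation (vol t)"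
    using sums_expectation_vol[of "\<lambda>_. 1" t] by (simp add: expectation_innov)
  then show ?thesis using sums_unique2[OF sums_zero] by metis
qed

text \<open>Orthogonality at different times leaves at most one term in the series, that with k = t
  - 1 - s, which is a natural number only if s < t.\<close>

lemma lag_sums:
  "(\<lambda>k. lam k * (if t - 1 - int k = s then c else 0)) sums (if s < t then lam (nat (t - 1 - s)) * c else 0)"
proof (cases "s < t")
  case True
  have "(\<lambda>k. lam k * (if t - 1 - int k = s then c else 0)) =
      (\<lambda>k. if k = nat (t - 1 - s) then lam k * c else 0)"
    using True by (auto intro!: ext)
  then show ?thesis
    using True sums_single[of "nat (t - 1 - s)" "\<lambda>k. lam k * c"] by simp
next
  case False
  then have "(\<lambda>k. lam k * (if t - 1 - int k = s then c else 0)) = (\<lambda>_. 0)"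
    by (auto intro!: ext)
  then show ?thesis using False by simp
qed

text \<open>\<open>vol t\<close> involves the noise strictly before t only, so the correlation
  vanishes unless s < t. The noise at time s carries the weight with index t - 1 - s: this is the
  origin of the index |h| - 1 in the autocovariance.\<close>

lemma expectation_vol_logZ:
  "expectation (\<lambda>x. vol t x * logZ s x) =
    (if s < t then lam (nat (t - 1 - s)) * covar M (news M \<theta> \<gamma> (Z 0)) (log_sq (Z 0)) else 0)"
  using sums_expectation_vol[of "logZ s" t] square_integrable_logZ[of s]
  by (intro sums_unique2[OF _ lag_sums]) (simp add: expectation_innov_logZ)

lemma expectation_innov_vol:
  "expectation (\<lambda>x. innov (Z s x) * vol t x) = (if s < t then lam (nat (t - 1 - s)) * innov_var else 0)"
proof -
  have "expectation (\<lambda>x. innov (Z s x) * vol t x) = expectation (\<lambda>x. vol t x * innov (Z s x))"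
    by (simp add: mult.commute)
  also have "\<dots> = (if s < t then lam (nat (t - 1 - s)) * innov_var else 0)"
    using sums_expectation_vol[of "\<lambda>x. innov (Z s x)" t] square_integrable_innov[of s]
    by (intro sums_unique2[OF _ lag_sums]) (simp add: expectation_innov_innov)
  finally show ?thesis .
qed

text \<open>Only the later factor is expanded, which avoids a double series. The noise in its k-th
  term precedes t exactly when k is at least n, and its weight in \<open>vol t\<close> then has
  index k - n; the first n terms drop out.\<close>

lemma expectation_vol_vol:
  "expectation (\<lambda>x. vol (t + int n) x * vol t x) = innov_var * (\<Sum>k. lam k * lam (k + n))"
proof (rule sums_unique2)
  let ?f = "\<lambda>k. lam k * expectation (\<lambda>x. innov (Z (t + int n - 1 - int k) x) * vol t x)"
  show "?f sums expectation (\<lambda>x. vol (t + int n) x * vol t x)"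
    by (rule sums_expectation_vol) (auto simp: square_integrable_vol)
  have "(\<lambda>k. ?f (k + n)) sums (innov_var * (\<Sum>k. lam k * lam (k + n)))"
  proof -
    have "?f (k + n) = innov_var * (lam k * lam (k + n))" for k
      by (simp add: expectation_innov_vol)
    then show ?thesis
      by (simp only: sums_mult summable_sums lam_mult_summable)
  qed
  moreover have "?f k = 0" if "k < n" for k
    using that by (simp add: expectation_innov_vol)
  ultimately show "?f sums (innov_var * (\<Sum>k. lam k * lam (k + n)))"
    by (subst (asm) sums_zero_iff_shift)
qed

section \<open>Moments, stationarity and ergodicity of the log-squares\<close>

definition mu :: real where "mu = \<omega> + expectation (log_sq (Z 0))"

lemma X_nonzero: "AE x in M. X t x \<noteq> 0"
  using X_eq[of t] sigma_pos[of t] Z_nonzero[of t] by eventually_elim simp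

text \<open>Mean, past noise and present noise are separated here. Splitting the logarithm of the
  product uses that volatility and noise are both nonzero almost surely.\<close>

lemma log_sq_X_eq: "AE x in M. log_sq (X t) x = mu + vol t x + logZ t x"
  using X_eq[of t] sigma_pos[of t] Z_nonzero[of t] sigma_eq[of t]
proof eventually_elim
  case (elim x)
  then have "ln ((X t x)\<^sup>2) = ln ((\<sigma> t x)\<^sup>2) + ln ((Z t x)\<^sup>2)"
    by (simp add: power_mult_distrib ln_mult)
  then show ?case using elim(4) by (simp add: log_sq_def vol_def logZ_def mu_def news_eq)
qed

lemma measurable_log_sq_X [measurable]: "log_sq (X t) \<in> borel_measurable M"
  using X_measurable unfolding log_sq_def[abs_def] by measurable

lemma integrable_vol: "integrable M (vol t)"
  by (rule square_integrable_imp_integrable[OF _ square_integrable_vol]) simp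

lemma integrable_logZ: "integrable M (logZ t)"
  by (rule square_integrable_imp_integrable[OF _ square_integrable_logZ]) simp

lemma expectation_log_sq_X: "expectation (log_sq (X t)) = mu"
proof -
  have "expectation (log_sq (X t)) = expectation (\<lambda>x. mu + vol t x + logZ t x)"
    using log_sq_X_eq by (intro integral_cong_AE) auto
  also have "\<dots> = mu"
    using integrable_vol integrable_logZ by (simp add: expectation_vol expectation_logZ prob_space)
  finally show ?thesis .
qed

lemma square_integrable_log_sq_X: "integrable M (\<lambda>x. (log_sq (X t) x)\<^sup>2)"
proof -
  have "integrable M (\<lambda>x. (mu + vol t x + logZ t x)\<^sup>2)"
    by (intro integrable_square_add) (auto simp: square_integrable_vol square_integrable_logZ)
  then show ?thesis
    by (rule integrable_cong_AE_imp) (use log_sq_X_eq[of t] in auto)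
qed

text \<open>At \<open>n = 0\<close> truncated subtraction turns \<open>lam (n - 1)\<close> into
  \<open>lam 0\<close>; the indicator removes that term, matching the convention for h = 0.\<close>

definition acov :: "nat \<Rightarrow> real" where
  "acov n = innov_var * (\<Sum>k. lam k * lam (k + n)) + variance (log_sq (Z 0)) * indicator {0} n
     + lam (n - 1) * covar M (news M \<theta> \<gamma> (Z 0)) (log_sq (Z 0)) * indicator (- {0}) n"

lemma covar_log_sq_X_nat: "covar M (log_sq (X (t + int n))) (log_sq (X t)) = acov n"
proof -
  let ?s = "t + int n"
  have *: "AE x in M. (log_sq (X ?s) x - mu) * (log_sq (X t) x - mu) =
      vol ?s x * vol t x + vol ?s x * logZ t x + vol t x * logZ ?s x + logZ ?s x * logZ t x"
    using log_sq_X_eq[of ?s] log_sq_X_eq[of t] by eventually_elim (simp add: algebra_simps)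
  have int: "integrable M (\<lambda>x. vol s x * vol t x)" "integrable M (\<lambda>x. vol s x * logZ t x)"
      "integrable M (\<lambda>x. logZ s x * logZ t x)" for s t
    by (auto intro!: integrable_mult_square simp: square_integrable_vol square_integrable_logZ)
  have "covar M (log_sq (X ?s)) (log_sq (X t)) =
      expectation (\<lambda>x. (log_sq (X ?s) x - mu) * (log_sq (X t) x - mu))"
    by (simp add: covar_def expectation_log_sq_X)
  also have "\<dots> = expectation (\<lambda>x. vol ?s x * vol t x + vol ?s x * logZ t x + vol t x * logZ ?s x + logZ ?s x * logZ t x)"
    using * by (intro integral_cong_AE) auto
  also have "\<dots> = expectation (\<lambda>x. vol ?s x * vol t x) + expectation (\<lambda>x. vol ?s x * logZ t x)
      + expectation (\<lambda>x. vol t x * logZ ?s x) + expectation (\<lambda>x. logZ ?s x * logZ t x)"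
    using int by simp
  also have "\<dots> = acov n"
    \<comment> \<open>The product of \<open>vol t\<close> with the later log-noise vanishes. The
      other mixed product contributes for n > 0 only, the product of the two log-noises for n = 0
      only.\<close>
    unfolding expectation_vol_vol expectation_vol_logZ expectation_logZ_logZ acov_def
    by (cases "n = 0") (auto simp: nat_diff_distrib)
  finally show ?thesis .
qed

lemma covar_log_sq_X: "covar M (log_sq (X (t + h))) (log_sq (X t)) = acov (nat \<bar>h\<bar>)"
proof (cases "h \<ge> 0")
  case True
  then show ?thesis using covar_log_sq_X_nat[of t "nat h"] by simp
next
  case False
  then show ?thesis
    using covar_log_sq_X_nat[of "t + h" "nat (- h)"] by (simp add: covar_commute)
qed

lemma weakly_stationary_log_sq_X: "weakly_stationary M (\<lambda>t. log_sq (X t))"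
  unfolding weakly_stationary_def
proof (intro conjI allI)
  show "covar M (log_sq (X (t + h))) (log_sq (X t)) = covar M (log_sq (X h)) (log_sq (X 0))" for t h
    using covar_log_sq_X[of t h] covar_log_sq_X[of 0 h] by simp
qed (auto simp: square_integrable_log_sq_X expectation_log_sq_X)

lemma stationary_ergodic_log_sq_X:
  "strictly_stationary M (\<lambda>t. log_sq (X t))" "ergodic M (\<lambda>t. log_sq (X t))"
proof -
  \<comment> \<open>Coordinate 0 is the present and -1 - k the past, so moving the path by t
    recovers the series for time t. The mean of the log-noise, added in \<open>mu\<close> and
    subtracted in \<open>logZ\<close>, cancels. As \<open>suminf\<close> is total, \<open>F\<close>
    is defined and measurable on the whole path space.\<close>
  define F where "F z = \<omega> + (\<Sum>k. lam k * innov (z (- 1 - int k))) + ln ((z 0)\<^sup>2)" for z :: "int \<Rightarrow> real"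
  have F: "F \<in> borel_measurable (PiM UNIV (\<lambda>_. borel))"
    unfolding F_def[abs_def] by measurable
  have eq: "AE x in M. log_sq (X t) x = F (\<lambda>s. Z (s + t) x)" for t
    using log_sq_X_eq[of t]
    by eventually_elim (simp add: F_def vol_def logZ_def mu_def algebra_simps)
  show "strictly_stationary M (\<lambda>t. log_sq (X t))"
    by (rule strictly_stationary_iid_factor[OF Z_indep Z_ident F _ eq]) simp
  show "ergodic M (\<lambda>t. log_sq (X t))"
    by (rule ergodic_iid_factor[OF Z_indep Z_ident F _ eq]) simp
qed

lemma ext_log_sq_X_finite: "AE x in M. \<bar>ext_log_sq (X t) x\<bar> \<noteq> \<infinity>"
  using X_nonzero[of t] by eventually_elim (simp add: ext_log_sq_def ext_ln_def)

end

theorem theorem4: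
  fixes M :: "'a measure" and Z \<sigma> X :: "int \<Rightarrow> 'a \<Rightarrow> real"
    and p q :: nat and d \<omega> \<theta> \<gamma> :: real and \<alpha> \<beta> lam :: "nat \<Rightarrow> real"
  assumes "fiegarch M Z p d q \<omega> \<theta> \<gamma> \<alpha> \<beta> lam \<sigma> X"
    and "(\<integral>\<^sup>+x. e2ennreal ((ext_log_sq (Z 0) x)\<^sup>2) \<partial>M) < \<infinity>"
    and "d < 1 / 2"
  shows "(\<forall>t. AE x in M. summable (\<lambda>k. lam k * news M \<theta> \<gamma> (Z (t - 1 - int k)) x)) \<and>
    (\<forall>t. AE x in M. \<bar>ext_log_sq (X t) x\<bar> \<noteq> \<infinity>) \<and>
    weakly_stationary M (\<lambda>t. log_sq (X t)) \<and>
    strictly_stationary M (\<lambda>t. log_sq (X t)) \<and>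
    ergodic M (\<lambda>t. log_sq (X t)) \<and>
    (\<forall>h::int. summable (\<lambda>k. lam k * lam (k + nat \<bar>h\<bar>))) \<and>
    (\<forall>t h::int. covar M (log_sq (X (t + h))) (log_sq (X t)) =
        (\<theta>\<^sup>2 + \<gamma>\<^sup>2 - (\<gamma> * prob_space.expectation M (\<lambda>x. \<bar>Z 0 x\<bar>))\<^sup>2
           + 2 * \<theta> * \<gamma> * prob_space.expectation M (\<lambda>x. Z 0 x * \<bar>Z 0 x\<bar>))
          * (\<Sum>k. lam k * lam (k + nat \<bar>h\<bar>))
        + prob_space.variance M (log_sq (Z 0)) * indicator {0} h
        + lam (nat \<bar>h\<bar> - 1) * covar M (news M \<theta> \<gamma> (Z 0)) (log_sq (Z 0)) * indicator (- {0}) h)"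
proof -
  interpret fiegarch_L2 M Z p d q \<omega> \<theta> \<gamma> \<alpha> \<beta> lam \<sigma> X
    using assms by (simp add: fiegarch_L2_def fiegarch_L2_axioms_def)
  have "acov (nat \<bar>h\<bar>) = innov_var * (\<Sum>k. lam k * lam (k + nat \<bar>h\<bar>))
      + variance (log_sq (Z 0)) * indicator {0} h
      + lam (nat \<bar>h\<bar> - 1) * covar M (news M \<theta> \<gamma> (Z 0)) (log_sq (Z 0)) * indicator (- {0}) h" for h :: int
    by (simp add: acov_def indicator_def)
  then show ?thesis
    using vol_summable ext_log_sq_X_finite weakly_stationary_log_sq_X stationary_ergodic_log_sq_X
      lam_mult_summable covar_log_sq_X
    by (simp add: news_eq innov_var_def)
qed

end
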